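(* Let $\|\cdot\|$ be an admissible norm on $\mathbb{R}^3$, and let $f:M\to(\mathbb{R}^3,\|\cdot\|)$ be an immersed surface with Birkhoff normal vector field $\eta$. Let $V\in T_pM$ be a principal direction at $p\in M$, with associated principal curvature $\lambda$. Then $k_{M,p}(V)=\lambda$.
   Context: Let $B$ and $\partial B$ be the unit ball and unit sphere of $\|\cdot\|$. The norm is admissible if it is smooth ($\partial B$ is locally the graph of a $C^\infty$ function), strictly convex ($\partial B$ contains no line segment), and $\partial B$ has positive Euclidean Gaussian curvature at every point. A non-zero vector $v$ is Birkhoff orthogonal to a 2-dimensional subspace $P$ ($v\dashv_B P$) if the plane through $v/\|v\|$ parallel to $P$ supports $B$; $v\dashv_B w$ means that $w$ lies in the plane $P$ with $v\dashv_B P$. For a smooth immersion of a surface, $M$ is identified with its image and $T_pM$ with the plane $df_p(T_pM)\subset\mathbb{R}^3$. A Birkhoff normal vector field is a (locally defined) smooth map $\eta$ into $\partial B$ with $\eta(p)\dashv_B T_pM$. Since $T_{\eta(p)}\partial B$ and $T_pM$ are the same plane, $d\eta_p$ is a linear endomorphism of $T_pM$; its eigenvalues are the principal curvatures and its (non-zero) eigenvectors the principal directions. Minkowski normal curvature $k_{M,p}(X)$: for $X\in T_pM$ with $\|X\|=1$, let $H=\mathrm{span}\{\eta(p),X\}$, oriented so that $(\eta(p),X)$ is a positive basis, and let $\gamma$ be the arc-length (in $\|\cdot\|$) parametrization of the curve $M\cap(p+H)$ near $p$ with $\gamma(0)=p$, $\gamma'(0)=X$. Then $k_{M,p}(X)$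 is the circular curvature of $\gamma$ at $p$ in the normed plane $(H,\|\cdot\|)$: if $\varphi(t)$ is the positively oriented arc-length parametrization of the unit circle $\partial B\cap H$, and $\eta_H(s)\in\partial B\cap H$ is the unit vector Birkhoff orthogonal in $H$ to $\gamma'(s)$ with $(\eta_H(s),\gamma'(s))$ positively oriented, write $\eta_H(s)=\varphi(t(s))$ with $\frac{d\varphi}{dt}(t(s))=\gamma'(s)$; the circular curvature at $\gamma(s)$ is $t'(s)$, i.e. $\eta_H'(s)=t'(s)\gamma'(s)$. For general non-zero $X\in T_pM$, $k_{M,p}(X):=k_{M,p}(X/\|X\|)$. *)

theory Defs
  imports "HOL-Analysis.Analysis"
begin

section \<open>Smooth maps on open sets\<close>

text \<open>
  The class \<open>C\<^sup>k\<close> on an open set \<open>S\<close> (only open sets are meant): iterated directional derivatives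
  of order less than \<open>k\<close> are differentiable on \<open>S\<close>, those of order \<open>k\<close> are continuous.
\<close>

primrec Ck_on :: "nat \<Rightarrow> 'a::euclidean_space set \<Rightarrow> ('a \<Rightarrow> 'b::euclidean_space) \<Rightarrow> bool" where
  "Ck_on 0 S g \<longleftrightarrow> continuous_on S g"
| "Ck_on (Suc k) S g \<longleftrightarrow>
     (\<forall>x\<in>S. g differentiable (at x)) \<and>
     (\<forall>v. Ck_on k S (\<lambda>x. frechet_derivative g (at x) v))"

definition smooth_on :: "'a::euclidean_space set \<Rightarrow> ('a \<Rightarrow> 'b::euclidean_space) \<Rightarrow> bool" where
  "smooth_on S g \<longleftrightarrow> (\<forall>k. Ck_on k S g)"


section \<open>Admissible norms on three-space\<close>

definition is_norm :: "(real^3 \<Rightarrow> real) \<Rightarrow> bool" where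
  "is_norm N \<longleftrightarrow>
     (\<forall>x. N x \<ge> 0) \<and> (\<forall>x. N x = 0 \<longleftrightarrow> x = 0) \<and>
     (\<forall>c x. N (c *\<^sub>R x) = \<bar>c\<bar> * N x) \<and> (\<forall>x y. N (x + y) \<le> N x + N y)"

definition unit_ball :: "(real^3 \<Rightarrow> real) \<Rightarrow> (real^3) set" where
  "unit_ball N = {x. N x \<le> 1}"

definition unit_sphere :: "(real^3 \<Rightarrow> real) \<Rightarrow> (real^3) set" where
  "unit_sphere N = {x. N x = 1}"

text \<open>The orthogonal map \<open>R\<close> makes the graph one over an arbitrary plane of three-space.\<close>

definition locally_smooth_graph :: "(real^3) set \<Rightarrow> bool" where
  "locally_smooth_graph S \<longleftrightarrow>
     (\<forall>q\<in>S. \<exists>(R :: real^3 \<Rightarrow> real^3) U D (g :: real^2 \<Rightarrow> real).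
        orthogonal_transformation R \<and> open U \<and> q \<in> U \<and> open D \<and> smooth_on D g \<and>
        S \<inter> U = (\<lambda>u. R (vector [u$1, u$2, g u])) ` D)"

definition regular_patch :: "(real^3) set \<Rightarrow> (real^2) set \<Rightarrow> (real^2 \<Rightarrow> real^3) \<Rightarrow> bool" where
  "regular_patch S D x \<longleftrightarrow>
     open D \<and> smooth_on D x \<and> x ` D \<subseteq> S \<and> (\<forall>u\<in>D. inj (frechet_derivative x (at u)))"

definition pderiv :: "2 \<Rightarrow> (real^2 \<Rightarrow> real^3) \<Rightarrow> real^2 \<Rightarrow> real^3" where
  "pderiv i x u = frechet_derivative x (at u) (axis i 1)"

text \<open>
  Quotient of the determinants of the second and first fundamental forms of a patch.
  It depends neither on the orientation nor on the choice of the patch around a point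
  of a regular surface, so positivity may be tested on all patches.
\<close>

definition gauss_curvature :: "(real^2 \<Rightarrow> real^3) \<Rightarrow> real^2 \<Rightarrow> real" where
  "gauss_curvature x u =
     (let x1 = pderiv 1 x u; x2 = pderiv 2 x u;
          n = cross3 x1 x2 /\<^sub>R norm (cross3 x1 x2);
          h11 = pderiv 1 (pderiv 1 x) u \<bullet> n;
          h12 = pderiv 1 (pderiv 2 x) u \<bullet> n;
          h22 = pderiv 2 (pderiv 2 x) u \<bullet> n
      in (h11 * h22 - h12\<^sup>2) / ((x1 \<bullet> x1) * (x2 \<bullet> x2) - (x1 \<bullet> x2)\<^sup>2))"

definition positive_gauss_curvature :: "(real^3) set \<Rightarrow> bool" where
  "positive_gauss_curvature S \<longleftrightarrow>
     (\<forall>D x. regular_patch S D x \<longrightarrow> (\<forall>u\<in>D. gauss_curvature x u > 0))"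

definition admissible_norm :: "(real^3 \<Rightarrow> real) \<Rightarrow> bool" where
  "admissible_norm N \<longleftrightarrow>
     is_norm N \<and>
     locally_smooth_graph (unit_sphere N) \<and>
     (\<forall>a b. a \<noteq> b \<longrightarrow> \<not> closed_segment a b \<subseteq> unit_sphere N) \<and>
     positive_gauss_curvature (unit_sphere N)"


section \<open>Birkhoff orthogonality\<close>

text \<open>
  Orthogonality inside the normed subspace \<open>H\<close>: the translate of the hyperplane \<open>P\<close> of \<open>H\<close>
  through the unit vector \<open>v /\<^sub>R N v\<close> is a supporting hyperplane of the unit ball of \<open>H\<close>.
  The dimension condition forces the functional \<open>a\<close> to be non-constant on \<open>H\<close>.
\<close>

definition birkhoff_orth_in ::
  "(real^3 \<Rightarrow> real) \<Rightarrow> (real^3) set \<Rightarrow> real^3 \<Rightarrow> (real^3) set \<Rightarrow> bool" where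
  "birkhoff_orth_in N H v P \<longleftrightarrow>
     v \<in> H \<and> v \<noteq> 0 \<and> subspace P \<and> P \<subseteq> H \<and> dim H = dim P + 1 \<and>
     (\<exists>a b. (+) (v /\<^sub>R N v) ` P = {x \<in> H. a \<bullet> x = b} \<and> (\<forall>x \<in> unit_ball N \<inter> H. a \<bullet> x \<le> b))"

text \<open>In the whole space the dimension condition says \<open>dim P = 2\<close>.\<close>

definition birkhoff_orth :: "(real^3 \<Rightarrow> real) \<Rightarrow> real^3 \<Rightarrow> (real^3) set \<Rightarrow> bool" where
  "birkhoff_orth N v P \<longleftrightarrow> birkhoff_orth_in N UNIV v P"


section \<open>Immersed surfaces and their Birkhoff normal fields\<close>

text \<open>
  An atlas is a set of local parametrizations \<open>(D, \<psi>)\<close>, where \<open>\<psi>\<close> maps the open set \<open>D\<close> of the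
  plane homeomorphically onto an open subset of the surface (inverses of charts).
\<close>

type_synonym 'm atlas = "((real^2) set \<times> (real^2 \<Rightarrow> 'm)) set"

definition smooth_surface :: "'m topology \<Rightarrow> 'm atlas \<Rightarrow> bool" where
  "smooth_surface M A \<longleftrightarrow>
     Hausdorff_space M \<and> second_countable M \<and>
     (\<Union>(D, \<psi>)\<in>A. \<psi> ` D) = topspace M \<and>
     (\<forall>(D, \<psi>)\<in>A. open D \<and> openin M (\<psi> ` D) \<and>
        homeomorphic_map (top_of_set D) (subtopology M (\<psi> ` D)) \<psi>) \<and>
     (\<forall>(D, \<psi>)\<in>A. \<forall>(D', \<psi>')\<in>A. smooth_on (D \<inter> \<psi> -` (\<psi>' ` D')) (inv_into D' \<psi>' \<circ> \<psi>))"

definition smooth_map_on :: "'m atlas \<Rightarrow> 'm set \<Rightarrow> ('m \<Rightarrow> real^3) \<Rightarrow> bool" where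
  "smooth_map_on A W g \<longleftrightarrow> (\<forall>(D, \<psi>)\<in>A. smooth_on (D \<inter> \<psi> -` W) (g \<circ> \<psi>))"

definition smooth_immersion :: "'m topology \<Rightarrow> 'm atlas \<Rightarrow> ('m \<Rightarrow> real^3) \<Rightarrow> bool" where
  "smooth_immersion M A f \<longleftrightarrow>
     smooth_map_on A (topspace M) f \<and>
     (\<forall>(D, \<psi>)\<in>A. \<forall>u\<in>D. inj (frechet_derivative (f \<circ> \<psi>) (at u)))"

text \<open>The plane \<open>df\<^sub>p(T\<^sub>pM)\<close>; it is the same for all parametrizations around \<open>p\<close>.\<close>

definition tangent_plane :: "'m atlas \<Rightarrow> ('m \<Rightarrow> real^3) \<Rightarrow> 'm \<Rightarrow> (real^3) set" where
  "tangent_plane A f p =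
     {X. \<exists>(D, \<psi>)\<in>A. \<exists>u\<in>D. \<psi> u = p \<and> (\<exists>h. X = frechet_derivative (f \<circ> \<psi>) (at u) h)}"

text \<open>
  The differential at \<open>p\<close> of a map \<open>g\<close> on the surface, as a function on \<open>df\<^sub>p(T\<^sub>pM)\<close>:
  the vector \<open>df\<^sub>p(h)\<close> is sent to \<open>dg\<^sub>p(h)\<close>.
\<close>

definition surface_differential ::
  "'m atlas \<Rightarrow> ('m \<Rightarrow> real^3) \<Rightarrow> ('m \<Rightarrow> real^3) \<Rightarrow> 'm \<Rightarrow> real^3 \<Rightarrow> real^3" where
  "surface_differential A f g p X =
     (THE Y. \<exists>(D, \<psi>)\<in>A. \<exists>u\<in>D. \<psi> u = p \<and>
        (\<exists>h. X = frechet_derivative (f \<circ> \<psi>) (at u) h \<and>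
             Y = frechet_derivative (g \<circ> \<psi>) (at u) h))"

definition birkhoff_normal_field ::
  "(real^3 \<Rightarrow> real) \<Rightarrow> 'm topology \<Rightarrow> 'm atlas \<Rightarrow> ('m \<Rightarrow> real^3) \<Rightarrow> 'm set \<Rightarrow> ('m \<Rightarrow> real^3) \<Rightarrow> bool"
  where
  "birkhoff_normal_field N M A f W \<eta> \<longleftrightarrow>
     openin M W \<and> smooth_map_on A W \<eta> \<and>
     (\<forall>q\<in>W. \<eta> q \<in> unit_sphere N \<and> birkhoff_orth N (\<eta> q) (tangent_plane A f q))"

definition principal_direction ::
  "'m atlas \<Rightarrow> ('m \<Rightarrow> real^3) \<Rightarrow> ('m \<Rightarrow> real^3) \<Rightarrow> 'm \<Rightarrow> real^3 \<Rightarrow> real \<Rightarrow> bool" where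
  "principal_direction A f \<eta> p V \<kappa> \<longleftrightarrow>
     V \<in> tangent_plane A f p \<and> V \<noteq> 0 \<and> surface_differential A f \<eta> p V = \<kappa> *\<^sub>R V"


section \<open>Circular curvature in a normed plane\<close>

text \<open>
  Throughout, the plane is \<open>span {e1, e2}\<close> for linearly independent \<open>e1\<close>, \<open>e2\<close>, oriented so that
  \<open>(e1, e2)\<close> is a positive basis.
\<close>

definition positive_basis :: "real^3 \<Rightarrow> real^3 \<Rightarrow> real^3 \<Rightarrow> real^3 \<Rightarrow> bool" where
  "positive_basis e1 e2 v w \<longleftrightarrow>
     (\<exists>v1 v2 w1 w2. v = v1 *\<^sub>R e1 + v2 *\<^sub>R e2 \<and> w = w1 *\<^sub>R e1 + w2 *\<^sub>R e2 \<and> v1 * w2 - v2 * w1 > 0)"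

definition unit_circle_param ::
  "(real^3 \<Rightarrow> real) \<Rightarrow> real^3 \<Rightarrow> real^3 \<Rightarrow> (real \<Rightarrow> real^3) \<Rightarrow> bool" where
  "unit_circle_param N e1 e2 \<phi> \<longleftrightarrow>
     \<phi> C1_differentiable_on UNIV \<and>
     range \<phi> = unit_sphere N \<inter> span {e1, e2} \<and>
     (\<forall>t. N (vector_derivative \<phi> (at t)) = 1 \<and>
          positive_basis e1 e2 (\<phi> t) (vector_derivative \<phi> (at t)))"

text \<open>
  The curve \<open>\<gamma>\<close> is assumed to run in a translate of the plane and to be parametrized by arc length
  near \<open>s0\<close>; its circular curvature at the parameter \<open>s0\<close> is \<open>k\<close>. The vector \<open>\<nu> s\<close> is the Birkhoff
  normal of \<open>\<gamma>\<close> in the plane.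
\<close>

definition has_circular_curvature ::
  "(real^3 \<Rightarrow> real) \<Rightarrow> real^3 \<Rightarrow> real^3 \<Rightarrow> (real \<Rightarrow> real^3) \<Rightarrow> real \<Rightarrow> real \<Rightarrow> bool" where
  "has_circular_curvature N e1 e2 \<gamma> s0 k \<longleftrightarrow>
     (\<exists>\<phi> \<nu> t. \<exists>\<epsilon>>0. unit_circle_param N e1 e2 \<phi> \<and>
        (\<forall>s\<in>{s0-\<epsilon><..<s0+\<epsilon>}.
           \<nu> s \<in> unit_sphere N \<and>
           birkhoff_orth_in N (span {e1, e2}) (\<nu> s) (span {vector_derivative \<gamma> (at s)}) \<and>
           positive_basis e1 e2 (\<nu> s) (vector_derivative \<gamma> (at s)) \<and>
           \<nu> s = \<phi> (t s) \<and>
           vector_derivative \<phi> (at (t s)) = vector_derivative \<gamma> (at s)) \<and>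
        (t has_real_derivative k) (at s0))"


section \<open>Minkowski normal curvature\<close>

text \<open>
  The curve \<open>f \<circ> c\<close> parametrizes by arc length the intersection of the surface near \<open>p\<close> with the
  plane \<open>f p + H\<close>, with initial velocity \<open>X\<close>. Since \<open>f\<close> need not be injective, the intersection is
  taken in the surface itself, in an open neighbourhood \<open>U\<close> of \<open>p\<close>.
\<close>

definition normal_section_param ::
  "(real^3 \<Rightarrow> real) \<Rightarrow> 'm topology \<Rightarrow> ('m \<Rightarrow> real^3) \<Rightarrow> 'm \<Rightarrow> (real^3) set \<Rightarrow> real^3 \<Rightarrow>
   (real \<Rightarrow> 'm) \<Rightarrow> bool" where
  "normal_section_param N M f p H X c \<longleftrightarrow>
     (\<exists>U. \<exists>\<epsilon>>0. openin M U \<and> p \<in> U \<and>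
        homeomorphic_map (top_of_set {-\<epsilon><..<\<epsilon>}) (subtopology M {q\<in>U. f q - f p \<in> H}) c \<and>
        c 0 = p \<and>
        (f \<circ> c) C1_differentiable_on {-\<epsilon><..<\<epsilon>} \<and>
        (\<forall>s\<in>{-\<epsilon><..<\<epsilon>}. N (vector_derivative (f \<circ> c) (at s)) = 1) \<and>
        vector_derivative (f \<circ> c) (at 0) = X)"

definition normal_curvature ::
  "(real^3 \<Rightarrow> real) \<Rightarrow> 'm topology \<Rightarrow> ('m \<Rightarrow> real^3) \<Rightarrow> ('m \<Rightarrow> real^3) \<Rightarrow> 'm \<Rightarrow> real^3 \<Rightarrow> real" where
  "normal_curvature N M f \<eta> p X =
     (let Y = X /\<^sub>R N X in
      THE k. \<exists>c. normal_section_param N M f p (span {\<eta> p, Y}) Y c \<and>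
                 has_circular_curvature N (\<eta> p) Y (f \<circ> c) 0 k)"

end

theory Submission
  imports Defs
begin

text \<open>
  Write \<open>G\<close> for the gradient of the norm, and fix a unit vector \<open>Y\<close> in the principal direction. A vector
  \<open>w\<close> is tangent to the surface at \<open>q\<close> exactly if \<open>G (\<eta> q) \<bullet> w = 0\<close>. Let \<open>\<gamma> = f \<circ> c\<close> be the normal section
  through \<open>p\<close> with velocity \<open>v\<close>, and let \<open>\<nu> = \<phi> \<circ> t\<close> be its Birkhoff normal inside the normal plane, where
  \<open>\<phi>\<close> runs through the unit circle of that plane. The velocity is tangent both to the surface and to
  the curve, so that along \<open>\<gamma>\<close>
    \<open>G (\<eta> (c s)) \<bullet> v s = 0\<close> and \<open>G (\<phi> (t s)) \<bullet> v s = 0\<close>.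
  The normals \<open>\<eta> (c s)\<close> and \<open>\<phi> (t s)\<close> differ in general, but they coincide at \<open>s = 0\<close> by strict convexity.
  Subtract the two equations, divide by \<open>s\<close> and let \<open>s\<close> tend to \<open>0\<close>. Because \<open>\<eta> \<circ> c\<close> has the derivative \<open>\<kappa> Y\<close>
  and \<open>\<phi>\<close> has the derivative \<open>Y\<close>, this gives \<open>(\<kappa> - t' 0) (DG Y \<bullet> Y) = 0\<close>. The second derivative
  \<open>DG Y \<bullet> Y\<close> of the norm at \<open>\<eta> p\<close> does not vanish because the Gaussian curvature of the unit sphere is
  positive, hence \<open>t' 0 = \<kappa>\<close>. The comparison is \<open>normal_speeds_agree\<close>.
  
  The comparison assumes of \<open>t\<close> only continuity at \<open>0\<close>, and its conclusion is differentiability. So it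
  serves twice: it determines the circular curvature of every admissible parametrization, and it shows
  that this curvature exists, once a continuous \<open>t\<close> has been selected among the zeros of
  \<open>\<tau> \<mapsto> G (\<phi> \<tau>) \<bullet> v s\<close> (\<open>simple_zero_selection\<close>). Both uses are combined in \<open>has_circular_curvature_iff\<close>.
  
  Three existence results support this. The local graphs of the unit sphere yield a differentiable
  gradient with \<open>DG Y \<bullet> Y \<noteq> 0\<close> on tangent vectors (\<open>admissible_imp_curved_norm\<close>). The unit circle of a
  normal plane has a unit speed parametrization on the whole line (\<open>unit_circle_param_exists\<close>).
  The normal section is a regular level curve of a linear functional on the surface, parametrized by
  arc length (\<open>normal_section_exists\<close>).
\<close>

section \<open>Smooth maps\<close>

lemma Ck_on_cong:
  assumes "open S" "\<And>x. x \<in> S \<Longrightarrow> f x = g x" "Ck_on k S f"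
  shows "Ck_on k S g"
  using assms(2,3)
proof (induction k arbitrary: f g)
  case 0
  have "continuous_on S f \<longleftrightarrow> continuous_on S g"
    by (rule continuous_on_cong[OF refl]) (rule 0(1))
  then show ?case using 0(2) by simp
next
  case (Suc k)
  have "g differentiable at x" if "x \<in> S" for x
  proof -
    obtain f' where "(f has_derivative f') (at x)"
      using Suc.prems(2) \<open>x \<in> S\<close> by (auto simp: differentiable_def)
    then have "(g has_derivative f') (at x)"
      by (rule has_derivative_transform_within_open[OF _ assms(1) \<open>x \<in> S\<close> Suc.prems(1)])
    then show ?thesis by (rule differentiableI)
  qed
  moreover have "Ck_on k S (\<lambda>x. frechet_derivative g (at x) v)" for v
  proof (rule Suc.IH[of "\<lambda>x. frechet_derivative f (at x) v"])
    show "frechet_derivative f (at x) v = frechet_derivative g (at x) v" if "x \<in> S" for x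
      using frechet_derivative_transform_within_open[of f x S g] Suc.prems that assms(1) by simp
    show "Ck_on k S (\<lambda>x. frechet_derivative f (at x) v)" using Suc.prems by simp
  qed
  ultimately show ?case by simp
qed

lemma linear_has_derivative:
  fixes L :: "'a::euclidean_space \<Rightarrow> 'b::real_normed_vector"
  assumes "linear L"
  shows "(L has_derivative L) F"
  using assms by (simp add: bounded_linear_imp_has_derivative linear_conv_bounded_linear)

lemma linear_graph_has_derivative:
  fixes A :: "'a::euclidean_space \<Rightarrow> 'c::euclidean_space" and B :: "'a \<Rightarrow> 'b::euclidean_space"
    and g :: "'b \<Rightarrow> real"
  assumes "linear A" "linear B" "g differentiable at (B u)"
  shows "((\<lambda>u. c + A u + g (B u) *\<^sub>R e) has_derivative
          (\<lambda>h. A h + frechet_derivative g (at (B u)) (B h) *\<^sub>R e)) (at u)"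
proof -
  have "(g has_derivative frechet_derivative g (at (B u))) (at (B u))"
    using assms(3) frechet_derivative_works by blast
  then have "((\<lambda>u. g (B u)) has_derivative (\<lambda>h. frechet_derivative g (at (B u)) (B h))) (at u)"
    using has_derivative_compose[OF linear_has_derivative[OF assms(2)]] by blast
  from has_derivative_add[OF has_derivative_add[OF has_derivative_const linear_has_derivative[OF assms(1)]]
      has_derivative_scaleR_left[OF this], of c e]
  show ?thesis by simp
qed

text \<open>
  Directional derivatives of such a map have the same shape, with \<open>A\<close> replaced by \<open>0\<close> and \<open>c\<close> by the
  constant \<open>A v\<close>; this is what carries the induction. The inner map \<open>B\<close> allows linear changes of the
  parameters of a graph.
\<close>

lemma Ck_on_linear_graph:
  fixes A :: "'a::euclidean_space \<Rightarrow> 'c::euclidean_space" and B :: "'a \<Rightarrow> 'b::euclidean_space"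
    and g :: "'b \<Rightarrow> real"
  assumes "linear A" "linear B" "open D" "Ck_on k D g"
  shows "Ck_on k (B -` D) (\<lambda>u. c + A u + g (B u) *\<^sub>R e)"
  using assms(1,4)
proof (induction k arbitrary: c A g)
  case 0
  have gB: "continuous_on (B -` D) (\<lambda>u. g (B u))"
  proof (rule continuous_on_compose2[of D g "B -` D" B])
    show "continuous_on D g" using 0 by simp
    show "continuous_on (B -` D) B"
      by (rule linear_continuous_on) (use assms(2) in \<open>simp add: linear_conv_bounded_linear\<close>)
  qed auto
  have "continuous_on (B -` D) A"
    by (rule linear_continuous_on) (use 0 in \<open>simp add: linear_conv_bounded_linear\<close>)
  then have "continuous_on (B -` D) (\<lambda>u. c + A u + g (B u) *\<^sub>R e)"
    by (intro continuous_on_add continuous_on_scaleR continuous_on_const gB)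
  then show ?case by simp
next
  case (Suc k)
  have op: "open (B -` D)"
    using assms(2,3) by (intro open_vimage linear_continuous_on) (auto simp: linear_conv_bounded_linear)
  let ?x = "\<lambda>u. c + A u + g (B u) *\<^sub>R e"
  have der: "(?x has_derivative (\<lambda>h. A h + frechet_derivative g (at (B u)) (B h) *\<^sub>R e)) (at u)"
    if "u \<in> B -` D" for u
    using Suc.prems that assms(2) by (intro linear_graph_has_derivative) auto
  have "Ck_on k (B -` D) (\<lambda>u. frechet_derivative ?x (at u) v)" for v
  proof (rule Ck_on_cong[OF op])
    show "A v + 0 + frechet_derivative g (at (B u)) (B v) *\<^sub>R e = frechet_derivative ?x (at u) v"
      if "u \<in> B -` D" for u
      using fun_cong[OF frechet_derivative_at[OF der[OF that]], of v] by simp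
    have "linear (\<lambda>u::'a. 0::'c)" by (simp add: linear_zero)
    then show "Ck_on k (B -` D) (\<lambda>u. A v + 0 + frechet_derivative g (at (B u)) (B v) *\<^sub>R e)"
      using Suc.IH[of "\<lambda>u. 0" "\<lambda>w. frechet_derivative g (at w) (B v)" "A v"] Suc.prems(2) by simp
  qed
  moreover have "?x differentiable at u" if "u \<in> B -` D" for u
    using der[OF that] by (rule differentiableI)
  ultimately show ?case by simp
qed

lemma smooth_on_differentiable:
    assumes "smooth_on S g" "x \<in> S"
  shows "g differentiable at x"
proof -
  have "Ck_on (Suc 0) S g" using assms(1) unfolding smooth_on_def by blast
  then show ?thesis using assms(2) by simp
qed

lemma smooth_on_derivative_differentiable:
  assumes "smooth_on S g" "x \<in> S"
  shows "(\<lambda>x. frechet_derivative g (at x) v) differentiable at x"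
proof -
  have "Ck_on (Suc (Suc 0)) S g" using assms(1) unfolding smooth_on_def by blast
  then show ?thesis using assms(2) by simp
qed

lemma smooth_on_derivative_continuous:
  assumes "smooth_on S g"
  shows "continuous_on S (\<lambda>x. frechet_derivative g (at x) v)"
proof -
  have "Ck_on (Suc 0) S g" using assms unfolding smooth_on_def by blast
  then show ?thesis by simp
qed

section \<open>Graphs of positive curvature\<close>

lemma linear_vector_3:
  fixes R :: "real^3 \<Rightarrow> 'b::real_vector"
  assumes "linear R"
  shows "R (vector [a, b, c]) = a *\<^sub>R R (axis 1 1) + b *\<^sub>R R (axis 2 1) + c *\<^sub>R R (axis 3 1)"
proof -
  have "vector [a, b, c] = a *\<^sub>R axis 1 1 + b *\<^sub>R axis 2 1 + c *\<^sub>R axis (3::3) (1::real)"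
    by (simp add: vec_eq_iff forall_3 axis_def)
  then show ?thesis by (simp add: linear_add[OF assms] linear_scale[OF assms])
qed

text \<open>
  Reparametrize the graph by a linear isomorphism \<open>B\<close> of the plane that sends the first basis vector to
  \<open>v\<close>. Then the first diagonal entry \<open>h11\<close> of the second fundamental form is a multiple of the
  second derivative of \<open>g\<close> along \<open>v\<close>, and it cannot vanish, since the determinant
  \<open>h11 * h22 - h12\<^sup>2\<close> is positive.
\<close>

lemma hessian_nonzero_of_positive_gauss_curvature:
  fixes R :: "real^3 \<Rightarrow> real^3" and g :: "real^2 \<Rightarrow> real"
  assumes pos: "positive_gauss_curvature S" and R: "orthogonal_transformation R"
    and D: "open D" "smooth_on D g" and sub: "(\<lambda>u. R (vector [u$1, u$2, g u])) ` D \<subseteq> S"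
    and w: "w \<in> D" and v: "v \<noteq> 0"
  shows "frechet_derivative (\<lambda>z. frechet_derivative g (at z) v) (at w) v \<noteq> 0"
proof -
  have lin: "linear R" using R by (simp add: orthogonal_transformation_linear)
  \<comment> \<open>The second basis vector goes to \<open>v\<close> rotated by a right angle.\<close>
  define B where "B = (\<lambda>u::real^2. u$1 *\<^sub>R v + u$2 *\<^sub>R (vector [- v$2, v$1] :: real^2))"
  have linB: "linear B"
    unfolding B_def by (rule linearI) (auto simp: algebra_simps)
  have injB: "h = 0" if "B h = 0" for h
  proof -
    have "h$1 * v$1 - h$2 * v$2 = 0" "h$1 * v$2 + h$2 * v$1 = 0"
      using arg_cong[OF that, of "\<lambda>x. x$1"] arg_cong[OF that, of "\<lambda>x. x$2"]
      by (simp_all add: B_def)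
    moreover have "v$1 \<noteq> 0 \<or> v$2 \<noteq> 0" using v by (auto simp: vec_eq_iff forall_2)
    moreover have "h$1 * ((v$1)\<^sup>2 + (v$2)\<^sup>2) = v$1 * (h$1 * v$1 - h$2 * v$2) + v$2 * (h$1 * v$2 + h$2 * v$1)"
      "h$2 * ((v$1)\<^sup>2 + (v$2)\<^sup>2) = v$1 * (h$1 * v$2 + h$2 * v$1) - v$2 * (h$1 * v$1 - h$2 * v$2)"
      by (simp_all add: power2_eq_square algebra_simps)
    ultimately show ?thesis
      by (auto simp: vec_eq_iff forall_2 sum_power2_eq_zero_iff)
  qed
  have "inj B" using injB linB linear_injective_0 by blast
  then have "surj B" using linB linear_injective_imp_surjective by blast
  then obtain u where u: "B u = w" by (metis surjD)
  have B1: "B (axis 1 1) = v" and B2: "B (axis 2 1) = vector [- v$2, v$1]"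
    by (simp_all add: B_def axis_def)
  define E where "E = (\<lambda>i::3. R (axis i (1::real)))"
  define A where "A = (\<lambda>u. (B u)$1 *\<^sub>R E 1 + (B u)$2 *\<^sub>R E 2)"
  have linA: "linear A"
    unfolding A_def by (rule linearI) (auto simp: algebra_simps linear_add[OF linB] linear_scale[OF linB])
  define x where "x = (\<lambda>u. 0 + A u + g (B u) *\<^sub>R E 3)"
  have Rvec: "R (vector [a, b, c]) = a *\<^sub>R E 1 + b *\<^sub>R E 2 + c *\<^sub>R E 3" for a b c
    using linear_vector_3[OF lin] by (simp add: E_def)
  have op: "open (B -` D)"
    using linB D(1) by (intro open_vimage linear_continuous_on) (auto simp: linear_conv_bounded_linear)
  have der: "frechet_derivative x (at u) = (\<lambda>h. A h + frechet_derivative g (at (B u)) (B h) *\<^sub>R E 3)"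
    if "u \<in> B -` D" for u
    unfolding x_def
    using linear_graph_has_derivative[OF linA linB, of g u 0 "E 3"] smooth_on_differentiable[OF D(2)] that
    by (simp add: frechet_derivative_at[symmetric])
  have "regular_patch S (B -` D) x"
    unfolding regular_patch_def
  proof (intro conjI ballI)
    show "open (B -` D)" by (rule op)
    show "smooth_on (B -` D) x"
      using D(2) Ck_on_linear_graph[OF linA linB D(1)] unfolding smooth_on_def x_def by blast
    show "x ` (B -` D) \<subseteq> S"
      using sub by (auto simp: x_def A_def Rvec image_subset_iff)
    fix u assume u: "u \<in> B -` D"
    have "h = 0" if "frechet_derivative x (at u) h = 0" for h
    proof -
      have "R (vector [(B h)$1, (B h)$2, frechet_derivative g (at (B u)) (B h)]) = 0"
        using that by (simp add: der[OF u] A_def Rvec)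
      then have "norm (R (vector [(B h)$1, (B h)$2, frechet_derivative g (at (B u)) (B h)])) = 0" by simp
      then have "vector [(B h)$1, (B h)$2, frechet_derivative g (at (B u)) (B h)] = (0 :: real^3)"
        by (simp only: orthogonal_transformation_norm[OF R] norm_eq_zero)
      then have "B h = 0" by (simp add: vec_eq_iff forall_2 forall_3)
      then show ?thesis by (rule injB)
    qed
    moreover have "linear (frechet_derivative x (at u))"
    proof -
      have "x differentiable at u"
        unfolding x_def differentiable_def
        using linear_graph_has_derivative[OF linA linB] smooth_on_differentiable[OF D(2)] u by blast
      then show ?thesis by (simp add: linear_frechet_derivative)
    qed
    ultimately show "inj (frechet_derivative x (at u))" using linear_injective_0 by blast
  qed
  then have gp: "gauss_curvature x u > 0"
    using pos u w unfolding positive_gauss_curvature_def by blast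
  define H where "H = (\<lambda>a b. frechet_derivative (\<lambda>z. frechet_derivative g (at z) b) (at w) a)"
  have second: "pderiv i (pderiv j x) u = H (B (axis i 1)) (B (axis j 1)) *\<^sub>R E 3" for i j
  proof -
    let ?b = "B (axis j 1)"
    let ?y = "\<lambda>z. A (axis j 1) + 0 + frechet_derivative g (at (B z)) ?b *\<^sub>R E 3"
    have "linear (\<lambda>u::real^2. 0::real^3)" by (simp add: linear_zero)
    then have "(?y has_derivative
        (\<lambda>h. 0 + frechet_derivative (\<lambda>z. frechet_derivative g (at z) ?b) (at (B u)) (B h) *\<^sub>R E 3)) (at u)"
      using linear_graph_has_derivative[of "\<lambda>u. 0" B "\<lambda>w. frechet_derivative g (at w) ?b" u "A (axis j 1)" "E 3"]
        linB smooth_on_derivative_differentiable[OF D(2)] u w by simp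
    then have "(pderiv j x has_derivative (\<lambda>h. 0 + H (B h) ?b *\<^sub>R E 3)) (at u)"
    proof (rule has_derivative_transform_within_open[OF _ op, THEN has_derivative_eq_rhs])
      show "u \<in> B -` D" using u w by simp
      show "?y z = pderiv j x z" if "z \<in> B -` D" for z
        using that by (simp add: pderiv_def der)
    qed (simp add: H_def u)
    then show ?thesis
      by (simp add: pderiv_def frechet_derivative_at[symmetric])
  qed
  define x1 where "x1 = pderiv 1 x u"
  define x2 where "x2 = pderiv 2 x u"
  define n where "n = cross3 x1 x2 /\<^sub>R norm (cross3 x1 x2)"
  have "H v v \<noteq> 0"
  proof
    assume 0: "H v v = 0"
    have "gauss_curvature x u = - (pderiv 1 (pderiv 2 x) u \<bullet> n)\<^sup>2 / ((x1 \<bullet> x1) * (x2 \<bullet> x2) - (x1 \<bullet> x2)\<^sup>2)"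
      unfolding gauss_curvature_def Let_def x1_def[symmetric] x2_def[symmetric] n_def[symmetric]
      using 0 by (simp add: second[of 1 1] B1)
    moreover have "(x1 \<bullet> x1) * (x2 \<bullet> x2) - (x1 \<bullet> x2)\<^sup>2 \<ge> 0"
      using Cauchy_Schwarz_ineq[of x1 x2] by simp
    ultimately have "gauss_curvature x u \<le> 0"
      by (simp add: divide_nonpos_nonneg)
    with gp show False by simp
  qed
  then show ?thesis by (simp add: H_def)
qed

section \<open>Differentiability of an admissible norm\<close>

locale norm_on_space =
  fixes N :: "real^3 \<Rightarrow> real"
  assumes is_norm: "is_norm N"
begin

lemma N_nonneg: "N x \<ge> 0" and N_eq_0 [simp]: "N x = 0 \<longleftrightarrow> x = 0"
  and N_scale: "N (c *\<^sub>R x) = \<bar>c\<bar> * N x" and N_triangle: "N (x + y) \<le> N x + N y"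
  using is_norm unfolding is_norm_def by auto

lemma N_zero [simp]: "N 0 = 0"
  by simp

lemma N_pos: "x \<noteq> 0 \<Longrightarrow> N x > 0"
  using N_nonneg[of x] by (simp add: order_less_le)

lemma N_minus [simp]: "N (- x) = N x"
  using N_scale[of "-1" x] by simp

lemma N_normalize: "x \<noteq> 0 \<Longrightarrow> N (x /\<^sub>R N x) = 1"
  using N_pos[of x] by (simp add: N_scale)

lemma N_bound: obtains C where "C > 0" "\<And>h. N h \<le> C * norm h"
proof
  let ?C = "\<Sum>i\<in>UNIV. N (axis i 1)"
  show "1 + ?C > 0" using N_nonneg by (simp add: add_pos_nonneg sum_nonneg)
  fix h :: "real^3"
  have sub: "N (sum f I) \<le> (\<Sum>i\<in>I. N (f i))" if "finite I" for f :: "3 \<Rightarrow> real^3" and I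
    using that
  proof (induction I)
    case (insert i I)
    then show ?case using N_triangle[of "f i" "sum f I"] by simp
  qed simp
  have "N h = N (\<Sum>i\<in>UNIV. h$i *\<^sub>R axis i 1)"
    by (simp add: basis_expansion scalar_mult_eq_scaleR[symmetric])
  also have "\<dots> \<le> (\<Sum>i\<in>UNIV. N (h$i *\<^sub>R axis i 1))"
    by (rule sub) simp
  also have "\<dots> \<le> (\<Sum>i\<in>UNIV. norm h * N (axis i 1))"
    by (intro sum_mono) (auto simp: N_scale component_le_norm_cart intro!: mult_right_mono N_nonneg)
  also have "\<dots> = ?C * norm h" by (simp add: sum_distrib_left mult.commute)
  also have "\<dots> \<le> (1 + ?C) * norm h" by (intro mult_right_mono) auto
  finally show "N h \<le> (1 + ?C) * norm h" .
qed

lemma N_diff_le: "\<bar>N x - N y\<bar> \<le> N (x - y)"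
  using N_triangle[of "x - y" y] N_triangle[of "y - x" x] N_minus[of "x - y"] by (simp add: abs_le_iff)

lemma N_continuous: "continuous (at x) N"
proof -
  obtain C where C: "C > 0" "\<And>h. N h \<le> C * norm h" using N_bound by blast
  have "C-lipschitz_on UNIV N"
  proof (rule lipschitz_onI)
    show "dist (N x) (N y) \<le> C * dist x y" for x y
      using N_diff_le[of x y] C(2)[of "x - y"] by (simp add: dist_norm)
  qed (use C in auto)
  then have "continuous_on UNIV N" by (rule lipschitz_on_continuous_on)
  then show ?thesis by (simp add: continuous_on_eq_continuous_at)
qed

lemma normalize_continuous: "x \<noteq> 0 \<Longrightarrow> continuous (at x) (\<lambda>x. x /\<^sub>R N x)"
  by (intro continuous_intros N_continuous) simp

text \<open>
  The sphere is the level set of \<open>F\<close>, and translation along \<open>e\<close> changes \<open>F\<close> at unit rate. If the radial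
  derivative of \<open>F\<close> were zero, the point \<open>(1 + r) y\<close> would reach the sphere by a shift along \<open>e\<close> of size
  \<open>o(r)\<close>, whereas its norm exceeds \<open>1\<close> by \<open>r\<close>.
\<close>

lemma level_function_transversal:
  assumes y: "N y = 1" and F: "(F has_derivative (\<lambda>h. n \<bullet> h)) (at y)"
    and U: "open U" "y \<in> U" and lev: "\<And>z. z \<in> U \<Longrightarrow> F z = 0 \<longleftrightarrow> N z = 1"
    and shift: "\<And>z s. F (z + s *\<^sub>R e) = F z + s"
  shows "n \<bullet> y \<noteq> 0"
proof
  assume 0: "n \<bullet> y = 0"
  define q where "q = (\<lambda>r. F (y + r *\<^sub>R y))"
  have "((\<lambda>r. y + r *\<^sub>R y) has_derivative (\<lambda>r. r *\<^sub>R y)) (at 0)"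
    by (auto intro!: derivative_eq_intros)
  then have qd: "(q has_derivative (\<lambda>r. 0)) (at 0)"
    using has_derivative_compose[of "\<lambda>r. y + r *\<^sub>R y" "\<lambda>r. r *\<^sub>R y" 0 UNIV F "\<lambda>h. n \<bullet> h"] F 0
    unfolding q_def by simp
  have q0: "q 0 = 0" using lev U y by (simp add: q_def)
  \<comment> \<open>Small enough that a shift by \<open>\<epsilon> * r\<close> along \<open>e\<close> changes the norm by less than \<open>r\<close>.\<close>
  define \<epsilon> where "\<epsilon> = 1 / (2 * (N e + 1))"
  have \<epsilon>: "\<epsilon> > 0" "\<epsilon> * N e < 1"
    using N_nonneg[of e] by (auto simp: \<epsilon>_def divide_simps)
  from qd \<epsilon>(1) obtain d where d: "d > 0" "\<And>r. \<bar>r\<bar> < d \<Longrightarrow> \<bar>q r\<bar> \<le> \<epsilon> * \<bar>r\<bar>"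
    unfolding has_derivative_at_alt by (force simp: q0)
  have "continuous (at 0) (\<lambda>r. y + r *\<^sub>R y - q r *\<^sub>R e)"
    using has_derivative_continuous[OF qd] by (intro continuous_intros)
  moreover have "y + 0 *\<^sub>R y - q 0 *\<^sub>R e \<in> U" using U q0 by simp
  ultimately have "\<forall>\<^sub>F r in at 0. y + r *\<^sub>R y - q r *\<^sub>R e \<in> U"
    using U(1) unfolding isCont_def by (intro topological_tendstoD) auto
  then obtain d' where d': "d' > 0" "\<And>r. r \<noteq> 0 \<Longrightarrow> \<bar>r\<bar> < d' \<Longrightarrow> y + r *\<^sub>R y - q r *\<^sub>R e \<in> U"
    unfolding eventually_at by (auto simp: dist_norm)
  define r where "r = min d d' / 2"
  have r: "r > 0" "\<bar>r\<bar> < d" "\<bar>r\<bar> < d'" using d d' by (auto simp: r_def)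
  let ?z = "y + r *\<^sub>R y - q r *\<^sub>R e"
  have "F ?z = 0" using shift[of "y + r *\<^sub>R y" "- q r"] by (simp add: q_def)
  then have "N ?z = 1" using lev d'(2)[of r] r by simp
  moreover have "N (y + r *\<^sub>R y) \<le> N ?z + N (q r *\<^sub>R e)"
    using N_triangle[of ?z "q r *\<^sub>R e"] by simp
  moreover have "N (y + r *\<^sub>R y) = 1 + r"
    using N_scale[of "1 + r" y] y r by (simp add: scaleR_add_left)
  ultimately have "r \<le> \<bar>q r\<bar> * N e" by (simp add: N_scale)
  also have "\<dots> \<le> \<epsilon> * \<bar>r\<bar> * N e" using d(2)[of r] r by (intro mult_right_mono N_nonneg) auto
  also have "\<dots> = (\<epsilon> * N e) * r" using r by simp
  also have "\<dots> < 1 * r" using \<epsilon> r by (intro mult_strict_right_mono)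
  finally show False by simp
qed

text \<open>
  Implicit differentiation: the projection \<open>z /\<^sub>R N z\<close> stays on the level set, so the first order
  expansion of \<open>F\<close> at \<open>y\<close>, applied to it and multiplied by \<open>N z\<close>, is an expansion of \<open>N z\<close>. The error is
  controlled because \<open>N\<close> is Lipschitz.
\<close>

lemma N_has_derivative_of_level_function:
  assumes y: "N y = 1" and F: "(F has_derivative (\<lambda>h. n \<bullet> h)) (at y)"
    and U: "open U" "y \<in> U" and lev: "\<And>z. z \<in> U \<Longrightarrow> N z = 1 \<Longrightarrow> F z = 0"
    and ny: "n \<bullet> y \<noteq> 0"
  shows "(N has_derivative (\<lambda>h. (n /\<^sub>R (n \<bullet> y)) \<bullet> h)) (at y)"
  unfolding has_derivative_at_alt
proof (intro conjI allI impI)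
  show "bounded_linear (\<lambda>h. (n /\<^sub>R (n \<bullet> y)) \<bullet> h)" by (rule bounded_linear_inner_right)
  fix e :: real assume e: "e > 0"
  obtain C where C: "C > 0" "\<And>h. N h \<le> C * norm h" using N_bound by blast
  \<comment> \<open>\<open>N z *\<^sub>R (z /\<^sub>R N z - y)\<close> is at most \<open>K\<close> times as long as \<open>z - y\<close>.\<close>
  define K where "K = 1 + C * norm y"
  have K: "K > 0" using C by (simp add: K_def add_pos_nonneg)
  define e' where "e' = e * \<bar>n \<bullet> y\<bar> / K"
  have e': "e' > 0" using e K ny by (simp add: e'_def)
  have y0: "y \<noteq> 0" using y N_eq_0[of y] by auto
  from F e' obtain d where d: "d > 0"
    "\<And>z. norm (z - y) < d \<Longrightarrow> norm (F z - F y - n \<bullet> (z - y)) \<le> e' * norm (z - y)"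
    unfolding has_derivative_at_alt by blast
  let ?p = "\<lambda>x. x /\<^sub>R N x"
  have py: "?p y = y" using y by simp
  have "(?p \<longlongrightarrow> ?p y) (nhds y)"
    using normalize_continuous[OF y0] by (simp only: isCont_def tendsto_at_iff_tendsto_nhds[of ?p y])
  then have "\<forall>\<^sub>F z in nhds y. ?p z \<in> U \<inter> ball y d"
    by (rule topological_tendstoD) (use U d(1) py in auto)
  moreover have "\<forall>\<^sub>F z in nhds y. z \<noteq> 0"
    using t1_space_nhds[OF y0] by simp
  ultimately have "\<forall>\<^sub>F z in nhds y. ?p z \<in> U \<inter> ball y d \<and> z \<noteq> 0"
    by eventually_elim auto
  then obtain d' where d': "d' > 0"
    "\<And>z. dist z y < d' \<Longrightarrow> ?p z \<in> U \<inter> ball y d \<and> z \<noteq> 0"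
    unfolding eventually_nhds_metric by blast
  show "\<exists>d>0. \<forall>z. norm (z - y) < d \<longrightarrow>
      norm (N z - N y - (n /\<^sub>R (n \<bullet> y)) \<bullet> (z - y)) \<le> e * norm (z - y)"
  proof (intro exI[of _ d'] conjI allI impI)
    show "d' > 0" by fact
    fix z assume "norm (z - y) < d'"
    then have z: "?p z \<in> U" "norm (?p z - y) < d" "z \<noteq> 0"
      using d'(2)[of z] by (auto simp: dist_norm norm_minus_commute)
    have Nz: "N z > 0" using z N_pos by simp
    have "F (?p z) = 0" "F y = 0" using lev z U y N_normalize by auto
    with d(2)[OF z(2)] have "\<bar>n \<bullet> (?p z - y)\<bar> \<le> e' * norm (?p z - y)" by simp
    then have "N z * \<bar>n \<bullet> (?p z - y)\<bar> \<le> N z * (e' * norm (?p z - y))"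
      using Nz by (intro mult_left_mono) auto
    moreover have w: "N z *\<^sub>R (?p z - y) = (z - y) - (N z - 1) *\<^sub>R y"
      using z(3) by (simp add: algebra_simps)
    moreover have "N z * \<bar>n \<bullet> (?p z - y)\<bar> = \<bar>n \<bullet> (N z *\<^sub>R (?p z - y))\<bar>"
      using Nz by (simp add: abs_mult)
    moreover have "N z * norm (?p z - y) = norm (N z *\<^sub>R (?p z - y))"
      using Nz by simp
    ultimately have *: "\<bar>n \<bullet> (z - y) - (N z - 1) * (n \<bullet> y)\<bar> \<le> e' * norm ((z - y) - (N z - 1) *\<^sub>R y)"
      by (simp add: inner_diff_right mult.left_commute)
    have "\<bar>N z - 1\<bar> \<le> C * norm (z - y)"
      using N_diff_le[of z y] C(2)[of "z - y"] y by simp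
    then have "norm ((z - y) - (N z - 1) *\<^sub>R y) \<le> norm (z - y) + C * norm (z - y) * norm y"
      by (intro order_trans[OF norm_triangle_ineq4]) (auto intro!: mult_right_mono)
    also have "\<dots> = K * norm (z - y)" by (simp add: K_def algebra_simps)
    finally have "\<bar>n \<bullet> (z - y) - (N z - 1) * (n \<bullet> y)\<bar> \<le> e' * (K * norm (z - y))"
      using * e' by (meson mult_left_mono order_trans less_imp_le)
    also have "e' * (K * norm (z - y)) = \<bar>n \<bullet> y\<bar> * (e * norm (z - y))"
      using K by (simp add: e'_def)
    also have "n \<bullet> (z - y) - (N z - 1) * (n \<bullet> y)
        = - (n \<bullet> y) * (N z - N y - (n /\<^sub>R (n \<bullet> y)) \<bullet> (z - y))"
      using ny y by (simp add: field_simps)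
    finally show "norm (N z - N y - (n /\<^sub>R (n \<bullet> y)) \<bullet> (z - y)) \<le> e * norm (z - y)"
      using ny by (simp add: abs_mult)
  qed
qed

lemma N_has_derivative_radial:
  assumes "x \<noteq> 0" "(N has_derivative (\<lambda>h. a \<bullet> h)) (at (x /\<^sub>R N x))"
  shows "(N has_derivative (\<lambda>h. a \<bullet> h)) (at x)"
proof -
  have Nx: "N x > 0" using assms(1) by (rule N_pos)
  have "((\<lambda>z. z /\<^sub>R N x) has_derivative (\<lambda>z. z /\<^sub>R N x)) (at x)"
    by (intro derivative_eq_intros) auto
  from has_derivative_mult_right[OF has_derivative_compose[OF this assms(2)], of "N x"]
  have "((\<lambda>z. N x * N (z /\<^sub>R N x)) has_derivative (\<lambda>h. N x * (a \<bullet> (h /\<^sub>R N x)))) (at x)" .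
  then show ?thesis using Nx assms(1) by (simp add: N_scale mult.assoc[symmetric])
qed

end

definition gradient :: "('a::euclidean_space \<Rightarrow> real) \<Rightarrow> 'a \<Rightarrow> 'a" where
  "gradient F x = (\<Sum>b\<in>Basis. frechet_derivative F (at x) b *\<^sub>R b)"

lemma gradient_eqI:
  assumes "(F has_derivative (\<lambda>h. a \<bullet> h)) (at x)"
  shows "gradient F x = a"
  using frechet_derivative_at[OF assms] unfolding gradient_def
  by (metis (no_types, lifting) euclidean_representation sum.cong)

lemma frechet_derivative_inner_const:
  fixes n :: "'a::euclidean_space \<Rightarrow> 'b::euclidean_space"
  assumes "n differentiable (at q)"
  shows "frechet_derivative (\<lambda>z. n z \<bullet> Y) (at q) h = frechet_derivative n (at q) h \<bullet> Y"
proof -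
  have "((\<lambda>z. n z \<bullet> Y) has_derivative (\<lambda>h. frechet_derivative n (at q) h \<bullet> Y)) (at q)"
    using assms by (intro has_derivative_inner_left) (simp add: frechet_derivative_works)
  from fun_cong[OF frechet_derivative_at[OF this], of h] show ?thesis by simp
qed

context norm_on_space
begin

text \<open>
  In the coordinates of a local graph over the first two axes \<open>E 1\<close>, \<open>E 2\<close>, the field \<open>n\<close> is the normal
  \<open>(- \<partial>\<^sub>1 g, - \<partial>\<^sub>2 g, 1)\<close>, extended constantly along the third axis. So the quadratic form
  \<open>Y \<mapsto> Dn Y \<bullet> Y\<close> is minus the Hessian of \<open>g\<close>, applied to the first two coordinates of \<open>Y\<close>.
\<close>

lemma graph_normal_field:
  assumes S: "locally_smooth_graph (unit_sphere N)" "positive_gauss_curvature (unit_sphere N)"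
    and q: "N q = 1"
  obtains O' n where "open O'" "q \<in> O'"
    "\<And>y. y \<in> O' \<Longrightarrow> n differentiable (at y)"
    "\<And>y. y \<in> O' \<Longrightarrow> N y = 1 \<Longrightarrow> n y \<bullet> y \<noteq> 0"
    "\<And>y. y \<in> O' \<Longrightarrow> N y = 1 \<Longrightarrow> (N has_derivative (\<lambda>h. (n y /\<^sub>R (n y \<bullet> y)) \<bullet> h)) (at y)"
    "\<And>Y. Y \<noteq> 0 \<Longrightarrow> n q \<bullet> Y = 0 \<Longrightarrow> frechet_derivative n (at q) Y \<bullet> Y \<noteq> 0"
proof -
  have "q \<in> unit_sphere N" using q by (simp add: unit_sphere_def)
  from bspec[OF S(1)[unfolded locally_smooth_graph_def] this] show thesis
  proof (elim exE conjE)
    fix R :: "real^3 \<Rightarrow> real^3" and U D and g :: "real^2 \<Rightarrow> real"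
    assume R: "orthogonal_transformation R" and U: "open U" "q \<in> U" and D: "open D" "smooth_on D g"
      and SU: "unit_sphere N \<inter> U = (\<lambda>u. R (vector [u$1, u$2, g u])) ` D"
    have lin: "linear R" using R by (rule orthogonal_transformation_linear)
    define E where "E = (\<lambda>i::3. R (axis i (1::real)))"
    have EE: "E i \<bullet> E j = (if i = j then 1 else 0)" for i j
    proof -
      have "E i \<bullet> E j = axis i 1 \<bullet> (axis j 1 :: real^3)"
        using R unfolding orthogonal_transformation_def E_def by blast
      then show ?thesis by (simp add: inner_axis_axis)
    qed
    define P where "P = (\<lambda>a b c. a *\<^sub>R E 1 + b *\<^sub>R E 2 + c *\<^sub>R E 3)"
    have RP: "R (vector [a, b, c]) = P a b c" for a b c
      using linear_vector_3[OF lin] by (simp add: P_def E_def)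
    have rep: "z = P (z \<bullet> E 1) (z \<bullet> E 2) (z \<bullet> E 3)" for z
    proof -
      obtain w where w: "z = R w"
        using orthogonal_transformation_surj[OF R] by (metis surjD)
      have "w = vector [w$1, w$2, w$3]" by (simp add: vec_eq_iff forall_3)
      then have "z = P (w$1) (w$2) (w$3)" using w RP by metis
      then show ?thesis by (simp add: P_def inner_add_left EE)
    qed
    define p where "p = (\<lambda>z. vector [z \<bullet> E 1, z \<bullet> E 2] :: real^2)"
    have linp: "linear p"
      by (rule linearI) (auto simp: p_def vec_eq_iff forall_2 inner_add_left)
    define O' where "O' = U \<inter> p -` D"
    have opO: "open O'"
      unfolding O'_def using linp D(1) U
      by (intro open_Int open_vimage linear_continuous_on) (auto simp: linear_conv_bounded_linear)
    define F where "F = (\<lambda>z. z \<bullet> E 3 - g (p z))"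
    have F0: "F z = 0 \<longleftrightarrow> N z = 1" if z: "z \<in> O'" for z
    proof
      assume "F z = 0"
      then have "z = R (vector [p z $ 1, p z $ 2, g (p z)])"
        using rep[of z] by (simp add: F_def RP p_def)
      then have "z \<in> unit_sphere N \<inter> U"
        unfolding SU using z by (auto simp: O'_def)
      then show "N z = 1" by (simp add: unit_sphere_def)
    next
      assume "N z = 1"
      then have "z \<in> unit_sphere N \<inter> U" using z by (simp add: O'_def unit_sphere_def)
      then obtain u where u: "u \<in> D" "z = P (u$1) (u$2) (g u)" unfolding SU by (auto simp: RP)
      have "p z = u" "z \<bullet> E 3 = g u"
        unfolding u(2) by (simp_all add: p_def P_def inner_add_left EE vec_eq_iff forall_2)
      then show "F z = 0" by (simp add: F_def)
    qed
    have qO: "q \<in> O'"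
    proof -
      have "q \<in> unit_sphere N \<inter> U" using q U by (simp add: unit_sphere_def)
      then obtain u where u: "u \<in> D" "q = P (u$1) (u$2) (g u)" unfolding SU by (auto simp: RP)
      have "p q = u" unfolding u(2) by (simp add: p_def P_def inner_add_left EE vec_eq_iff forall_2)
      then show ?thesis using U u by (simp add: O'_def)
    qed
    have shift: "F (z + s *\<^sub>R E 3) = F z + s" for z s
      by (simp add: F_def p_def inner_add_left EE)
    define dg where "dg = (\<lambda>z. frechet_derivative g (at (p z)))"
    define n where "n = (\<lambda>z. E 3 - dg z (axis 1 1) *\<^sub>R E 1 - dg z (axis 2 1) *\<^sub>R E 2)"
    have gd: "(g has_derivative dg z) (at (p z))" if "z \<in> O'" for z
      using that smooth_on_differentiable[OF D(2)] unfolding dg_def O'_def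
      by (simp add: frechet_derivative_works[symmetric])
    have nh: "n z \<bullet> h = h \<bullet> E 3 - dg z (p h)" if "z \<in> O'" for z h
    proof -
      have l: "linear (dg z)" using gd[OF that] by (rule has_derivative_linear)
      have "p h = (h \<bullet> E 1) *\<^sub>R axis 1 1 + (h \<bullet> E 2) *\<^sub>R axis 2 1"
        by (simp add: p_def vec_eq_iff forall_2 axis_def)
      then have "dg z (p h) = (h \<bullet> E 1) * dg z (axis 1 1) + (h \<bullet> E 2) * dg z (axis 2 1)"
        by (simp add: linear_add[OF l] linear_scale[OF l])
      then show ?thesis by (simp add: n_def inner_diff_left inner_commute[of h] mult.commute)
    qed
    have Fd: "(F has_derivative (\<lambda>h. n z \<bullet> h)) (at z)" if "z \<in> O'" for z
    proof -
      have "(F has_derivative (\<lambda>h. h \<bullet> E 3 - dg z (p h))) (at z)"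
        unfolding F_def
        by (intro has_derivative_diff has_derivative_inner_left has_derivative_ident
            has_derivative_compose[OF linear_has_derivative[OF linp] gd[OF that]])
      then show ?thesis by (simp add: nh[OF that])
    qed
    have dgd: "((\<lambda>z. dg z v) has_derivative
        (\<lambda>h. frechet_derivative (\<lambda>w. frechet_derivative g (at w) v) (at (p z)) (p h))) (at z)"
      if "z \<in> O'" for z v
    proof -
      have "(\<lambda>w. frechet_derivative g (at w) v) differentiable at (p z)"
        using that smooth_on_derivative_differentiable[OF D(2)] by (simp add: O'_def)
      then show ?thesis
        unfolding dg_def frechet_derivative_works
        using has_derivative_compose[OF linear_has_derivative[OF linp]] by blast
    qed
    have nd: "n differentiable (at z)" if "z \<in> O'" for z
      unfolding n_def
      by (intro differentiable_diff differentiable_const differentiable_scaleR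
          differentiableI[OF dgd[OF that]])
    have ny: "n y \<bullet> y \<noteq> 0" if "y \<in> O'" "N y = 1" for y
      using level_function_transversal[OF that(2) Fd[OF that(1)] opO that(1) F0 shift] .
    have Nd: "(N has_derivative (\<lambda>h. (n y /\<^sub>R (n y \<bullet> y)) \<bullet> h)) (at y)" if "y \<in> O'" "N y = 1" for y
      using N_has_derivative_of_level_function[OF that(2) Fd[OF that(1)] opO that(1)] F0 ny that by blast
    have curv: "frechet_derivative n (at q) Y \<bullet> Y \<noteq> 0" if Y: "Y \<noteq> 0" "n q \<bullet> Y = 0" for Y
    proof -
      have pY: "p Y \<noteq> 0"
      proof
        assume 0: "p Y = 0"
        then have "Y \<bullet> E 1 = 0" "Y \<bullet> E 2 = 0"
          by (simp_all add: p_def vec_eq_iff forall_2)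
        moreover have "linear (dg q)" using gd[OF qO] by (rule has_derivative_linear)
        then have "Y \<bullet> E 3 = 0" using nh[OF qO, of Y] Y(2) 0 by (simp add: linear_0)
        ultimately show False using rep[of Y] Y(1) by (simp add: P_def)
      qed
      let ?H = "frechet_derivative (\<lambda>w. frechet_derivative g (at w) (p Y)) (at (p q))"
      have "((\<lambda>z. Y \<bullet> E 3 - dg z (p Y)) has_derivative (\<lambda>h. 0 - ?H (p h))) (at q)"
        by (intro has_derivative_diff has_derivative_const dgd[OF qO])
      then have "((\<lambda>z. n z \<bullet> Y) has_derivative (\<lambda>h. 0 - ?H (p h))) (at q)"
        by (rule has_derivative_transform_within_open[OF _ opO qO]) (simp add: nh)
      from fun_cong[OF frechet_derivative_at[OF this], of Y]
      have "frechet_derivative n (at q) Y \<bullet> Y = - ?H (p Y)"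
        by (simp add: frechet_derivative_inner_const[OF nd[OF qO]])
      moreover have "?H (p Y) \<noteq> 0"
      proof (rule hessian_nonzero_of_positive_gauss_curvature[OF S(2) R D _ _ pY])
        show "(\<lambda>u. R (vector [u $ 1, u $ 2, g u])) ` D \<subseteq> unit_sphere N" using SU by blast
        show "p q \<in> D" using qO by (simp add: O'_def)
      qed
      ultimately show ?thesis by simp
    qed
    show thesis using that[OF opO qO nd ny Nd curv] .
  qed
qed

end

text \<open>
  The unit sphere enters only through the gradient of the norm: its tangent planes are the kernels of
  \<open>G\<close>, and the last condition says that it has no asymptotic directions.
\<close>

locale curved_norm = norm_on_space +
  fixes G :: "real^3 \<Rightarrow> real^3"
  assumes N_has_derivative: "x \<noteq> 0 \<Longrightarrow> (N has_derivative (\<lambda>h. G x \<bullet> h)) (at x)"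
    and G_differentiable: "x \<noteq> 0 \<Longrightarrow> G differentiable (at x)"
    and G_nondegenerate: "N x = 1 \<Longrightarrow> Y \<noteq> 0 \<Longrightarrow> G x \<bullet> Y = 0 \<Longrightarrow> frechet_derivative G (at x) Y \<bullet> Y \<noteq> 0"

text \<open>
  Near \<open>x\<close> the gradient is \<open>n / (n \<bullet> y)\<close> at \<open>y = x /\<^sub>R N x\<close>, where \<open>n\<close> is the normal of a local graph. In a
  tangent direction \<open>Y\<close> only the derivative of \<open>n\<close> contributes to \<open>DG Y \<bullet> Y\<close>: the scalar factor is
  differentiated against \<open>n \<bullet> Y = 0\<close>, and the derivative of the radial projection
  fixes tangent vectors.
\<close>

lemma admissible_imp_curved_norm:
  assumes "admissible_norm N"
  shows "curved_norm N (gradient N)"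
proof -
  interpret norm_on_space N
    using assms by unfold_locales (simp add: admissible_norm_def)
  have S: "locally_smooth_graph (unit_sphere N)" "positive_gauss_curvature (unit_sphere N)"
    using assms by (simp_all add: admissible_norm_def)
  let ?p = "\<lambda>x. x /\<^sub>R N x"
  have "(N has_derivative (\<lambda>h. gradient N x \<bullet> h)) (at x) \<and> gradient N differentiable (at x) \<and>
    (N x = 1 \<longrightarrow> (\<forall>Y. Y \<noteq> 0 \<longrightarrow> gradient N x \<bullet> Y = 0 \<longrightarrow> frechet_derivative (gradient N) (at x) Y \<bullet> Y \<noteq> 0))"
    if x: "x \<noteq> 0" for x
  proof -
    obtain O' n where O: "open O'" "?p x \<in> O'"
      and nd: "\<And>y. y \<in> O' \<Longrightarrow> n differentiable (at y)"
      and ny: "\<And>y. y \<in> O' \<Longrightarrow> N y = 1 \<Longrightarrow> n y \<bullet> y \<noteq> 0"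
      and Nd: "\<And>y. y \<in> O' \<Longrightarrow> N y = 1 \<Longrightarrow> (N has_derivative (\<lambda>h. (n y /\<^sub>R (n y \<bullet> y)) \<bullet> h)) (at y)"
      and curv: "\<And>Y. Y \<noteq> 0 \<Longrightarrow> n (?p x) \<bullet> Y = 0 \<Longrightarrow> frechet_derivative n (at (?p x)) Y \<bullet> Y \<noteq> 0"
      using graph_normal_field[OF S N_normalize[OF x]] by blast
    let ?G = "\<lambda>y. n y /\<^sub>R (n y \<bullet> y)"
    define O2 where "O2 = {z. z \<noteq> 0 \<and> ?p z \<in> O'}"
    have "continuous_on (- {0}) ?p"
      using normalize_continuous by (simp add: continuous_at_imp_continuous_on)
    then have "open (- {0} \<inter> ?p -` O')"
      by (rule continuous_open_preimage) (use O(1) in auto)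
    moreover have "- {0} \<inter> ?p -` O' = O2" by (auto simp: O2_def)
    ultimately have O2: "open O2" "x \<in> O2" using O x by (auto simp: O2_def)
    have Nz: "(N has_derivative (\<lambda>h. ?G (?p z) \<bullet> h)) (at z)" if "z \<in> O2" for z
    proof -
      have z: "z \<noteq> 0" "?p z \<in> O'" using that by (simp_all add: O2_def)
      show ?thesis by (rule N_has_derivative_radial[OF z(1) Nd[OF z(2) N_normalize[OF z(1)]]])
    qed
    have Gz: "gradient N z = ?G (?p z)" if "z \<in> O2" for z
      by (rule gradient_eqI) (rule Nz[OF that])
    have Nz': "(N has_derivative (\<lambda>h. gradient N z \<bullet> h)) (at z)" if "z \<in> O2" for z
      using Nz[OF that] by (simp only: Gz[OF that])
    have pd: "(?p has_derivative (\<lambda>h. (- (inverse (N x) * (gradient N x \<bullet> h) * inverse (N x))) *\<^sub>R x + h /\<^sub>R N x)) (at x)"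
    proof -
      have "N x \<noteq> 0" using x by simp
      from has_derivative_scaleR[OF Deriv.has_derivative_inverse[OF this Nz'[OF O2(2)]] has_derivative_ident]
      show ?thesis by (simp add: add.commute)
    qed
    have np: "(\<lambda>z. n (?p z)) differentiable (at x)"
      using differentiable_chain_at[OF differentiableI[OF pd] nd[OF O(2)]] by (simp add: o_def)
    have "(\<lambda>z. ?G (?p z)) differentiable (at x)"
      using ny[OF O(2) N_normalize[OF x]]
      by (intro differentiable_scaleR differentiable_inverse differentiable_inner np differentiableI[OF pd])
    then obtain G' where "((\<lambda>z. ?G (?p z)) has_derivative G') (at x)" by (auto simp: differentiable_def)
    then have Gd: "(gradient N has_derivative G') (at x)"
      by (rule has_derivative_transform_within_open[OF _ O2]) (simp add: Gz)
    have "frechet_derivative (gradient N) (at x) Y \<bullet> Y \<noteq> 0"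
      if Y: "N x = 1" "Y \<noteq> 0" "gradient N x \<bullet> Y = 0" for Y
    proof -
      have px: "?p x = x" using Y by simp
      have nxx: "n x \<bullet> x \<noteq> 0" using ny[OF O(2)] Y by simp
      have nY: "n x \<bullet> Y = 0" using Y(3) Gz[OF O2(2)] nxx px by simp
      have "(n has_derivative frechet_derivative n (at x)) (at (?p x))"
        using nd[OF O(2)] px by (simp add: frechet_derivative_works)
      from has_derivative_compose[OF pd this]
      have npd: "((\<lambda>z. n (?p z)) has_derivative (\<lambda>h. frechet_derivative n (at x)
           ((- (inverse (N x) * (gradient N x \<bullet> h) * inverse (N x))) *\<^sub>R x + h /\<^sub>R N x))) (at x)" .
      obtain d where d: "((\<lambda>z. inverse (n (?p z) \<bullet> ?p z)) has_derivative d) (at x)"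
        using np pd nxx px
          differentiable_inverse[OF differentiable_inner[OF np differentiableI[OF pd]]]
        by (auto simp: differentiable_def)
      have "((\<lambda>z. inverse (n (?p z) \<bullet> ?p z) * (n (?p z) \<bullet> Y)) has_derivative
        (\<lambda>h. inverse (n (?p x) \<bullet> ?p x) * (frechet_derivative n (at x)
           ((- (inverse (N x) * (gradient N x \<bullet> h) * inverse (N x))) *\<^sub>R x + h /\<^sub>R N x) \<bullet> Y)
           + d h * (n (?p x) \<bullet> Y))) (at x)"
        by (intro has_derivative_mult d has_derivative_inner_left npd)
      then have "((\<lambda>z. gradient N z \<bullet> Y) has_derivative
        (\<lambda>h. inverse (n (?p x) \<bullet> ?p x) * (frechet_derivative n (at x)
           ((- (inverse (N x) * (gradient N x \<bullet> h) * inverse (N x))) *\<^sub>R x + h /\<^sub>R N x) \<bullet> Y)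
           + d h * (n (?p x) \<bullet> Y))) (at x)"
        by (rule has_derivative_transform_within_open[OF _ O2]) (simp add: Gz)
      from fun_cong[OF frechet_derivative_at[OF this], of Y]
      have "frechet_derivative (gradient N) (at x) Y \<bullet> Y = inverse (n x \<bullet> x) * (frechet_derivative n (at x) Y \<bullet> Y)"
        using frechet_derivative_inner_const[OF differentiableI[OF Gd]] Y by (simp add: px nY)
      then show ?thesis using curv[of Y] px nY Y nxx by simp
    qed
    then show ?thesis using Nz'[OF O2(2)] Gd by (auto simp: differentiable_def)
  qed
  note main = this
  show ?thesis
  proof
    show "N x = 1 \<Longrightarrow> Y \<noteq> 0 \<Longrightarrow> gradient N x \<bullet> Y = 0 \<Longrightarrow>
        frechet_derivative (gradient N) (at x) Y \<bullet> Y \<noteq> 0" for x Y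
      using main[of x] by fastforce
  qed (use main in auto)
qed

lemma line_has_vector_derivative: "((\<lambda>r. x + r *\<^sub>R h) has_vector_derivative h) (at r)"
  for x h :: "'a::real_normed_vector"
  by (auto intro!: derivative_eq_intros)

context curved_norm
begin

lemma G_isCont: "x \<noteq> 0 \<Longrightarrow> isCont G x"
  by (simp add: G_differentiable differentiable_imp_continuous_within)

lemma N_curve_has_derivative:
  assumes "(c has_vector_derivative v) (at s)" "c s \<noteq> 0"
  shows "((\<lambda>s. N (c s)) has_real_derivative G (c s) \<bullet> v) (at s)"
proof -
  from has_derivative_compose[OF assms(1)[unfolded has_vector_derivative_def] N_has_derivative[OF assms(2)]]
  have "((\<lambda>s. N (c s)) has_derivative (\<lambda>r. G (c s) \<bullet> (r *\<^sub>R v))) (at s)" .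
  then show ?thesis by (simp add: has_field_derivative_def mult.commute[of _ "G (c s) \<bullet> v"])
qed

lemma G_self:
  assumes "x \<noteq> 0"
  shows "G x \<bullet> x = N x"
proof -
  have "((\<lambda>r. N (x + r *\<^sub>R x)) has_real_derivative G x \<bullet> x) (at 0)"
    using N_curve_has_derivative[OF line_has_vector_derivative[of x x 0]] assms by simp
  moreover have "((\<lambda>r. (1 + r) * N x) has_real_derivative N x) (at 0)"
    by (auto intro!: derivative_eq_intros)
  then have "((\<lambda>r. N (x + r *\<^sub>R x)) has_real_derivative N x) (at 0)"
  proof (rule has_field_derivative_transform_within[of _ _ _ _ 1])
    show "(1 + r) * N x = N (x + r *\<^sub>R x)" if "dist r 0 < 1" for r
      using N_scale[of "1 + r" x] that by (simp add: scaleR_add_left dist_norm)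
  qed auto
  ultimately show ?thesis by (rule DERIV_unique)
qed

lemma G_le:
  assumes "x \<noteq> 0"
  shows "G x \<bullet> h \<le> N h"
proof (rule ccontr)
  assume "\<not> ?thesis"
  then have gt: "G x \<bullet> h - N h > 0" by simp
  have "((\<lambda>r. N (x + r *\<^sub>R h) - r * N h) has_real_derivative G x \<bullet> h - N h) (at 0)"
    using N_curve_has_derivative[OF line_has_vector_derivative[of x h 0]] assms
    by (auto intro!: derivative_eq_intros)
  from DERIV_pos_inc_right[OF this gt] obtain d where
    d: "d > 0" "\<And>r. r > 0 \<Longrightarrow> r < d \<Longrightarrow> N x < N (x + r *\<^sub>R h) - r * N h"
    by auto
  have "N (x + (d/2) *\<^sub>R h) \<le> N x + (d/2) * N h"
    using N_triangle[of x "(d/2) *\<^sub>R h"] d(1) by (simp add: N_scale)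
  with d(2)[of "d/2"] d(1) show False by simp
qed

lemma unit_nonzero: "N x = 1 \<Longrightarrow> x \<noteq> 0"
  by auto

section \<open>Birkhoff orthogonality and the gradient\<close>

text \<open>
  If \<open>a \<bullet> x \<le> b\<close> supports the unit ball of \<open>H\<close> at \<open>v\<close>, then \<open>b * N x - a \<bullet> x\<close> is nonnegative on \<open>H\<close> and
  vanishes at \<open>v\<close>. So its derivative there is zero, which makes \<open>a\<close> proportional to \<open>G v\<close> on \<open>H\<close>.
\<close>

lemma birkhoff_orth_in_imp_kernel:
  assumes B: "birkhoff_orth_in N H v P" and v: "N v = 1" and H: "subspace H"
  shows "P = {h \<in> H. G v \<bullet> h = 0}"
proof -
  from B v obtain a b where vH: "v \<in> H" and P: "subspace P" "P \<subseteq> H" "dim H = dim P + 1"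
    and eq: "(+) v ` P = {x \<in> H. a \<bullet> x = b}" and le: "\<And>x. x \<in> unit_ball N \<inter> H \<Longrightarrow> a \<bullet> x \<le> b"
    unfolding birkhoff_orth_in_def by auto
  have "v \<in> (+) v ` P" using subspace_0[OF P(1)] by force
  then have av: "a \<bullet> v = b" using eq by simp
  have bound: "a \<bullet> x \<le> b * N x" if "x \<in> H" "x \<noteq> 0" for x
  proof -
    have "x /\<^sub>R N x \<in> unit_ball N \<inter> H"
      using that N_normalize H by (simp add: unit_ball_def subspace_scale)
    from le[OF this] show ?thesis using N_pos[OF that(2)] by (simp add: field_simps)
  qed
  have ah: "a \<bullet> h = b * (G v \<bullet> h)" if h: "h \<in> H" for h
  proof -
    define f where "f = (\<lambda>r. b * N (v + r *\<^sub>R h) - a \<bullet> (v + r *\<^sub>R h))"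
    have fd: "(f has_real_derivative b * (G v \<bullet> h) - a \<bullet> h) (at 0)"
      unfolding f_def inner_add_right inner_scaleR_right
      using N_curve_has_derivative[OF line_has_vector_derivative[of v h 0]] unit_nonzero[OF v]
      by (auto intro!: derivative_eq_intros)
    have "continuous (at 0) (\<lambda>r. v + r *\<^sub>R h)" by (intro continuous_intros)
    then have "\<forall>\<^sub>F r in at 0. v + r *\<^sub>R h \<noteq> 0"
      using unit_nonzero[OF v] unfolding isCont_def by (intro tendsto_imp_eventually_ne) auto
    then obtain d where d: "d > 0" "\<And>r. r \<noteq> 0 \<Longrightarrow> \<bar>r\<bar> < d \<Longrightarrow> v + r *\<^sub>R h \<noteq> 0"
      unfolding eventually_at by (auto simp: dist_norm)
    have f0: "f 0 = 0" using av v by (simp add: f_def)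
    have fge: "f r \<ge> 0" if "\<bar>r\<bar> < d" for r
    proof (cases "r = 0")
      case False
      have "v + r *\<^sub>R h \<in> H" using H vH h by (simp add: subspace_add subspace_scale)
      then show ?thesis using bound d(2)[OF False that] by (simp add: f_def)
    qed (simp add: f0)
    have "b * (G v \<bullet> h) - a \<bullet> h = 0"
      using fge f0 by (intro DERIV_local_min[OF fd d(1)]) auto
    then show ?thesis by simp
  qed
  have "b \<noteq> 0"
  proof
    assume b: "b = 0"
    then have "{x \<in> H. a \<bullet> x = b} = H" using ah by auto
    then have "(+) v ` P = H" using eq by simp
    moreover have "(+) v ` P \<subseteq> P"
    proof -
      obtain p where "p \<in> P" "v + p = 0" using \<open>(+) v ` P = H\<close> subspace_0[OF H] by force
      then have "v \<in> P" using P(1) by (metis add_eq_0_iff2 subspace_neg)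
      then show ?thesis using P(1) by (auto intro: subspace_add)
    qed
    ultimately have "H = P" using P(2) by auto
    then show False using P(3) by simp
  qed
  show ?thesis
  proof safe
    fix h assume h: "h \<in> P"
    then show "h \<in> H" using P by auto
    have "v + h \<in> {x \<in> H. a \<bullet> x = b}" using h eq by blast
    then have "a \<bullet> h = 0" using av by (simp add: inner_add_right)
    then show "G v \<bullet> h = 0" using ah[OF \<open>h \<in> H\<close>] \<open>b \<noteq> 0\<close> by simp
  next
    fix h assume h: "h \<in> H" "G v \<bullet> h = 0"
    then have "v + h \<in> {x \<in> H. a \<bullet> x = b}"
      using ah[of h] av vH H by (simp add: inner_add_right subspace_add)
    then show "h \<in> P" unfolding eq[symmetric] by auto
  qed
qed

text \<open>
  The functional \<open>G v\<close> supports the unit ball at \<open>v\<close>, by convexity and Euler's identity.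
\<close>

lemma kernel_imp_birkhoff_orth_in:
  assumes v: "N v = 1" "v \<in> H" and H: "subspace H" "dim H = 2"
    and w: "w \<in> H" "w \<noteq> 0" "G v \<bullet> w = 0"
  shows "birkhoff_orth_in N H v (span {w})"
proof -
  let ?K = "{h \<in> H. G v \<bullet> h = 0}"
  have K: "subspace ?K"
    using H(1) by (auto simp: subspace_def inner_add_right)
  have Gv: "G v \<bullet> v = 1" using G_self[OF unit_nonzero[OF v(1)]] v by simp
  have d1: "dim (span {w}) = 1" using w by (simp add: dim_insert)
  have sub: "span {w} \<subseteq> ?K" using K w by (intro span_minimal) auto
  have "dim ?K \<noteq> dim H"
  proof
    assume "dim ?K = dim H"
    then have "?K = H" using subspace_dim_equal[OF K H(1)] by auto
    then have "v \<in> ?K" using v(2) by blast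
    then show False using Gv by simp
  qed
  moreover have "dim ?K \<le> dim H" by (rule dim_subset) auto
  ultimately have "dim ?K \<le> dim (span {w})" using d1 H by simp
  then have eq: "span {w} = ?K" using sub K by (intro subspace_dim_equal) auto
  have "(+) (v /\<^sub>R N v) ` span {w} = {x \<in> H. G v \<bullet> x = 1}"
  proof safe
    fix h assume "h \<in> span {w}"
    then have "h \<in> ?K" using eq by simp
    then show "v /\<^sub>R N v + h \<in> H" "G v \<bullet> (v /\<^sub>R N v + h) = 1"
      using v H Gv by (auto simp: subspace_add inner_add_right)
  next
    fix x assume "x \<in> H" "G v \<bullet> x = 1"
    then have "x - v \<in> span {w}" unfolding eq using v H Gv by (simp add: subspace_diff inner_diff_right)
    then have "v + (x - v) \<in> (+) v ` span {w}" by (rule imageI)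
    then show "x \<in> (+) (v /\<^sub>R N v) ` span {w}" using v by simp
  qed
  moreover have "G v \<bullet> x \<le> 1" if "x \<in> unit_ball N \<inter> H" for x
    using that G_le[OF unit_nonzero[OF v(1)], of x] by (simp add: unit_ball_def)
  moreover have "span {w} \<subseteq> H" using w H by (simp add: span_minimal)
  ultimately show ?thesis
    unfolding birkhoff_orth_in_def using v(2) unit_nonzero[OF v(1)] H(2) d1
    by (intro conjI exI[of _ "G v"] exI[of _ "1::real"] ballI) auto
qed

text \<open>
  A line of the normal plane that is parallel to \<open>Y\<close> and supports the unit disc touches it at one point,
  because otherwise the sphere would contain a segment. There are two such lines, and the sign of \<open>a\<close>
  selects one of them.
\<close>

lemma oriented_birkhoff_normal_unique:
  assumes strict: "\<And>a b. a \<noteq> b \<Longrightarrow> \<not> closed_segment a b \<subseteq> unit_sphere N"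
    and x: "N x = 1" "G x \<bullet> Y = 0" and y: "N y = 1" "G y \<bullet> Y = 0"
    and yx: "y = a *\<^sub>R x + b *\<^sub>R Y" "a > 0"
  shows "y = x"
proof -
  have x0: "x \<noteq> 0" "y \<noteq> 0" using x y by auto
  have "G x \<bullet> y = a" using G_self[OF x0(1)] x yx by (simp add: inner_add_right)
  then have "a \<le> 1" using G_le[OF x0(1), of y] y by simp
  have "1 = a * (G y \<bullet> x)"
    using G_self[OF x0(2)] y arg_cong[OF yx(1), of "\<lambda>z. G y \<bullet> z"] by (simp add: inner_add_right)
  moreover have "G y \<bullet> x \<le> 1" using G_le[OF x0(2), of x] x by simp
  ultimately have "1 \<le> a" using yx(2) by (metis mult.right_neutral mult_left_mono less_imp_le)
  with \<open>a \<le> 1\<close> have a: "a = 1" by simp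
  have "closed_segment x y \<subseteq> unit_sphere N"
  proof
    fix z assume "z \<in> closed_segment x y"
    then obtain u where u: "0 \<le> u" "u \<le> 1" "z = (1 - u) *\<^sub>R x + u *\<^sub>R y"
      unfolding closed_segment_def by auto
    have "N z \<le> 1" using N_triangle[of "(1 - u) *\<^sub>R x" "u *\<^sub>R y"] u x y by (simp add: N_scale)
    moreover have "G x \<bullet> z = 1"
      using u \<open>G x \<bullet> y = a\<close> a G_self[OF x0(1)] x by (simp add: inner_add_right)
    then have "1 \<le> N z" using G_le[OF x0(1), of z] by simp
    ultimately show "z \<in> unit_sphere N" by (simp add: unit_sphere_def)
  qed
  then show ?thesis using strict[of x y] by auto
qed

end

section \<open>Comparing two normal fields along a curve\<close>

lemma has_vector_derivative_iff_slope:
  fixes P :: "real \<Rightarrow> 'a::real_normed_vector"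
  shows "(P has_vector_derivative Z) (at t) \<longleftrightarrow> ((\<lambda>s. (P s - P t) /\<^sub>R (s - t)) \<longlongrightarrow> Z) (at t)"
proof -
  let ?f = "\<lambda>s. norm (P s - P t - (s - t) *\<^sub>R Z) / norm (s - t)"
  let ?g = "\<lambda>s. norm ((P s - P t) /\<^sub>R (s - t) - Z)"
  have "?f s = ?g s" if "s \<noteq> t" for s
  proof -
    have "P s - P t - (s - t) *\<^sub>R Z = (s - t) *\<^sub>R ((P s - P t) /\<^sub>R (s - t) - Z)"
      using that by (simp add: scaleR_diff_right)
    then show ?thesis using that by simp
  qed
  then have "(?f \<longlongrightarrow> 0) (at t) \<longleftrightarrow> (?g \<longlongrightarrow> 0) (at t)"
    by (intro LIM_equal) blast
  then show ?thesis
    unfolding has_vector_derivative_def has_derivative_iff_norm tendsto_norm_zero_iff LIM_zero_iff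
    by (simp add: bounded_linear_scaleR_left)
qed

lemma has_vector_derivative_slope:
  fixes P :: "real \<Rightarrow> 'a::real_normed_vector"
  assumes "(P has_vector_derivative Z) (at t)"
  obtains A where "isCont A t" "A t = Z" "\<And>s. P s - P t = (s - t) *\<^sub>R A s"
proof
  let ?A = "\<lambda>s. if s = t then Z else (P s - P t) /\<^sub>R (s - t)"
  have "(?A \<longlongrightarrow> Z) (at t) \<longleftrightarrow> ((\<lambda>s. (P s - P t) /\<^sub>R (s - t)) \<longlongrightarrow> Z) (at t)"
    by (rule LIM_equal) simp
  then show "isCont ?A t" using assms by (simp add: isCont_def has_vector_derivative_iff_slope)
  show "?A t = Z" by simp
  show "P s - P t = (s - t) *\<^sub>R ?A s" for s by simp
qed

context curved_norm
begin

text \<open>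
  Both \<open>G \<circ> a\<close> and \<open>G \<circ> \<phi>\<close> have derivatives that are multiples of \<open>Z = DG Y\<close>. With difference quotients \<open>A\<close> and
  \<open>B\<close> that are continuous at the base point, the two orthogonality relations give
  \<open>(t s - t 0) * (A (t s) \<bullet> v s) = s * (B s \<bullet> v s)\<close>, where the inner products tend to \<open>Z \<bullet> Y \<noteq> 0\<close> and
  \<open>k * (Z \<bullet> Y)\<close>. Dividing yields the derivative of \<open>t\<close>.
\<close>

lemma normal_speeds_agree:
  assumes x: "N x = 1" and Y: "Y \<noteq> 0" "G x \<bullet> Y = 0"
    and a: "(a has_vector_derivative k *\<^sub>R Y) (at 0)" "a 0 = x"
    and \<phi>: "(\<phi> has_vector_derivative Y) (at (t 0))" "\<phi> (t 0) = x"
    and t: "isCont t (0::real)"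
    and v: "isCont v 0" "v 0 = Y"
    and orth: "\<forall>\<^sub>F s in at 0. G (a s) \<bullet> v s = 0 \<and> G (\<phi> (t s)) \<bullet> v s = 0"
  shows "(t has_real_derivative k) (at 0)"
proof -
  have x0: "x \<noteq> 0" using x by auto
  let ?Z = "frechet_derivative G (at x) Y"
  have Gd: "(G has_derivative frechet_derivative G (at x)) (at x)"
    using G_differentiable[OF x0] frechet_derivative_works by blast
  have Glin: "linear (frechet_derivative G (at x))" using Gd by (rule has_derivative_linear)
  have "((\<lambda>s. G (\<phi> s)) has_vector_derivative ?Z) (at (t 0))"
    using has_derivative_compose[OF \<phi>(1)[unfolded has_vector_derivative_def], of G "frechet_derivative G (at x)"]
      Gd \<phi>(2) by (simp add: has_vector_derivative_def linear_scale[OF Glin])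
  then obtain A where A: "isCont A (t 0)" "A (t 0) = ?Z"
    "\<And>s. G (\<phi> s) - G (\<phi> (t 0)) = (s - t 0) *\<^sub>R A s"
    by (rule has_vector_derivative_slope) (rule that)
  have "((\<lambda>s. G (a s)) has_vector_derivative k *\<^sub>R ?Z) (at 0)"
    using has_derivative_compose[OF a(1)[unfolded has_vector_derivative_def], of G "frechet_derivative G (at x)"]
      Gd a(2) by (simp add: has_vector_derivative_def linear_scale[OF Glin])
  then obtain B where B: "isCont B 0" "B 0 = k *\<^sub>R ?Z"
    "\<And>s. G (a s) - G (a 0) = (s - 0) *\<^sub>R B s"
    by (rule has_vector_derivative_slope) (rule that)
  have nz: "?Z \<bullet> Y \<noteq> 0" using G_nondegenerate[OF x Y] .
  have "isCont (\<lambda>s. A (t s)) 0" using isCont_o2[OF t A(1)] .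
  then have "isCont (\<lambda>s. A (t s) \<bullet> v s) 0" using v(1) by (intro continuous_intros)
  then have lim1: "((\<lambda>s. A (t s) \<bullet> v s) \<longlongrightarrow> ?Z \<bullet> Y) (at 0)" by (simp add: isCont_def A v)
  have "isCont (\<lambda>s. B s \<bullet> v s) 0" using v(1) B(1) by (intro continuous_intros)
  then have lim2: "((\<lambda>s. B s \<bullet> v s) \<longlongrightarrow> k * (?Z \<bullet> Y)) (at 0)" by (simp add: isCont_def B v)
  have "((\<lambda>s. (B s \<bullet> v s) / (A (t s) \<bullet> v s)) \<longlongrightarrow> k * (?Z \<bullet> Y) / (?Z \<bullet> Y)) (at 0)"
    by (rule tendsto_divide[OF lim2 lim1 nz])
  then have lim: "((\<lambda>s. (B s \<bullet> v s) / (A (t s) \<bullet> v s)) \<longlongrightarrow> k) (at 0)" using nz by simp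
  have "\<forall>\<^sub>F s in at 0. A (t s) \<bullet> v s \<noteq> 0"
    using tendsto_imp_eventually_ne[OF lim1 nz] .
  moreover have "\<forall>\<^sub>F s in at (0::real). s \<noteq> 0" by (simp add: eventually_at_filter)
  ultimately have "\<forall>\<^sub>F s in at 0. (B s \<bullet> v s) / (A (t s) \<bullet> v s) = (t s - t 0) / (s - 0)"
    using orth
  proof eventually_elim
    case (elim s)
    have "(t s - t 0) *\<^sub>R A (t s) - s *\<^sub>R B s = G (\<phi> (t s)) - G (a s)"
    proof -
      have "(t s - t 0) *\<^sub>R A (t s) - s *\<^sub>R B s = (G (\<phi> (t s)) - G x) - (G (a s) - G x)"
        using A(3)[of "t s"] B(3)[of s] a(2) \<phi>(2) by simp
      then show ?thesis by simp
    qed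
    then have "((t s - t 0) *\<^sub>R A (t s) - s *\<^sub>R B s) \<bullet> v s = 0"
      using elim by (simp add: inner_diff_left)
    then have "(t s - t 0) * (A (t s) \<bullet> v s) - s * (B s \<bullet> v s) = 0"
      by (simp only: inner_diff_left inner_scaleR_left)
    then have "(t s - t 0) * (A (t s) \<bullet> v s) = s * (B s \<bullet> v s)" by (simp only: right_minus_eq)
    then show ?case using elim by (simp add: frac_eq_eq mult.commute)
  qed
  with lim have "((\<lambda>s. (t s - t 0) / (s - 0)) \<longlongrightarrow> k) (at 0)"
    by (rule Lim_transform_eventually)
  then show ?thesis by (simp add: has_field_derivative_iff)
qed

end

section \<open>Continuous selection of a simple zero\<close>

text \<open>
  The function \<open>K 0\<close> changes sign at \<open>t0\<close>; for small \<open>s\<close> this persists at two points on either side of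
  \<open>t0\<close>, and the intermediate value theorem applies.
\<close>

lemma nearby_zero:
  fixes K :: "real \<Rightarrow> real \<Rightarrow> real"
  assumes K0: "K 0 t0 = 0" "(K 0 has_real_derivative \<beta>) (at t0)" "\<beta> \<noteq> 0"
    and cs: "\<And>\<tau>. isCont (\<lambda>s. K s \<tau>) 0"
    and ct: "\<forall>\<^sub>F s in at 0. continuous_on UNIV (K s)"
    and \<delta>: "\<delta> > 0"
  shows "\<forall>\<^sub>F s in at 0. \<exists>\<tau>. \<bar>\<tau> - t0\<bar> \<le> \<delta> \<and> K s \<tau> = 0"
proof -
  define L where "L = (\<lambda>s \<tau>. sgn \<beta> * K s \<tau>)"
  have Ld: "(L 0 has_real_derivative \<bar>\<beta>\<bar>) (at t0)"
    using DERIV_cmult[OF K0(2), of "sgn \<beta>"] by (simp add: L_def abs_sgn mult.commute)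
  have pos: "\<bar>\<beta>\<bar> > 0" using K0 by simp
  from DERIV_pos_inc_right[OF Ld pos] obtain d1 where
    d1: "d1 > 0" "\<And>h. 0 < h \<Longrightarrow> h < d1 \<Longrightarrow> L 0 t0 < L 0 (t0 + h)" by blast
  from DERIV_pos_inc_left[OF Ld pos] obtain d2 where
    d2: "d2 > 0" "\<And>h. 0 < h \<Longrightarrow> h < d2 \<Longrightarrow> L 0 (t0 - h) < L 0 t0" by blast
  define h where "h = min \<delta> (min d1 d2) / 2"
  have h: "0 < h" "h < d1" "h < d2" "h \<le> \<delta>" using d1 d2 \<delta> by (auto simp: h_def)
  have "L 0 t0 = 0" by (simp add: L_def K0)
  then have lr: "L 0 (t0 - h) < 0" "0 < L 0 (t0 + h)" using d1(2)[of h] d2(2)[of h] h by auto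
  have cL: "((\<lambda>s. L s \<tau>) \<longlongrightarrow> L 0 \<tau>) (at 0)" for \<tau>
    using cs[of \<tau>] unfolding L_def isCont_def by (intro tendsto_intros)
  have "\<forall>\<^sub>F s in at 0. L s (t0 - h) < 0" "\<forall>\<^sub>F s in at 0. 0 < L s (t0 + h)"
    by (rule order_tendstoD(2)[OF cL lr(1)], rule order_tendstoD(1)[OF cL lr(2)])
  then show ?thesis using ct
  proof eventually_elim
    case (elim s)
    have "continuous_on {t0 - h..t0 + h} (L s)"
      unfolding L_def by (rule continuous_on_mult_left[OF continuous_on_subset[OF elim(3)]]) simp
    then obtain \<tau> where "t0 - h \<le> \<tau>" "\<tau> \<le> t0 + h" "L s \<tau> = 0"
      using IVT'[of "L s" "t0 - h" 0 "t0 + h"] elim h by auto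
    then show ?case using K0(3) h by (intro exI[of _ \<tau>]) (auto simp: L_def sgn_eq_0_iff)
  qed
qed

text \<open>
  For \<open>s\<close> near \<open>0\<close> there are zeros arbitrarily close to \<open>t0\<close>. Selecting for each \<open>s\<close> a zero at minimal
  distance from \<open>t0\<close> therefore gives a function that is continuous at \<open>0\<close>.
\<close>

lemma simple_zero_selection:
  fixes K :: "real \<Rightarrow> real \<Rightarrow> real"
  assumes K0: "K 0 t0 = 0" "(K 0 has_real_derivative \<beta>) (at t0)" "\<beta> \<noteq> 0"
    and cs: "\<And>\<tau>. isCont (\<lambda>s. K s \<tau>) 0"
    and ct: "\<forall>\<^sub>F s in at 0. continuous_on UNIV (K s)"
  obtains t where "t 0 = t0" "isCont t 0" "\<forall>\<^sub>F s in at 0. K s (t s) = 0"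
proof -
  let ?near = "\<lambda>s \<tau>. K s \<tau> = 0 \<and> (\<forall>\<sigma>. K s \<sigma> = 0 \<longrightarrow> \<bar>\<tau> - t0\<bar> \<le> \<bar>\<sigma> - t0\<bar>)"
  have ex: "\<exists>\<tau>. ?near s \<tau>" if s: "continuous_on UNIV (K s)" and z: "K s \<sigma>0 = 0" for s \<sigma>0
  proof -
    let ?r = "\<bar>\<sigma>0 - t0\<bar>"
    let ?Z = "cball t0 ?r \<inter> {\<tau>. K s \<tau> = 0}"
    have "closed {\<tau>. K s \<tau> = 0}"
      using s by (intro closed_Collect_eq continuous_on_const)
    then have "compact ?Z" by (intro compact_Int_closed compact_cball)
    moreover have "\<sigma>0 \<in> ?Z" using z by (simp add: dist_real_def abs_minus_commute)
    moreover have "continuous_on ?Z (\<lambda>\<tau>. \<bar>\<tau> - t0\<bar>)" by (intro continuous_intros)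
    ultimately obtain \<tau> where \<tau>: "\<tau> \<in> ?Z" "\<And>\<sigma>. \<sigma> \<in> ?Z \<Longrightarrow> \<bar>\<tau> - t0\<bar> \<le> \<bar>\<sigma> - t0\<bar>"
      using continuous_attains_inf[of ?Z "\<lambda>\<tau>. \<bar>\<tau> - t0\<bar>"] by blast
    have "\<bar>\<tau> - t0\<bar> \<le> \<bar>\<sigma> - t0\<bar>" if "K s \<sigma> = 0" for \<sigma>
    proof (cases "\<sigma> \<in> ?Z")
      case False
      then show ?thesis using \<tau>(1) that by (auto simp: dist_real_def abs_minus_commute)
    qed (rule \<tau>(2))
    then show ?thesis using \<tau>(1) by blast
  qed
  define t where "t = (\<lambda>s. if s = 0 then t0 else SOME \<tau>. ?near s \<tau>)"
  have t: "?near s (t s)" if "s \<noteq> 0" "continuous_on UNIV (K s)" "K s \<sigma> = 0" for s \<sigma>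
    using someI_ex[OF ex[OF that(2,3)]] that(1) by (simp add: t_def)
  have s0: "\<forall>\<^sub>F s in at (0::real). s \<noteq> 0" by (simp add: eventually_at_filter)
  have near: "\<forall>\<^sub>F s in at 0. K s (t s) = 0 \<and> \<bar>t s - t0\<bar> \<le> \<delta>" if "\<delta> > 0" for \<delta>
    using nearby_zero[OF K0 cs ct that] ct s0
  proof eventually_elim
    case (elim s)
    then obtain \<tau> where "\<bar>\<tau> - t0\<bar> \<le> \<delta>" "K s \<tau> = 0" by blast
    with t[of s \<tau>] elim show ?case by force
  qed
  have "(t \<longlongrightarrow> t0) (at 0)"
  proof (rule tendstoI)
    fix e :: real assume "e > 0"
    then have "\<forall>\<^sub>F s in at 0. K s (t s) = 0 \<and> \<bar>t s - t0\<bar> \<le> e / 2" by (intro near) simp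
    then show "\<forall>\<^sub>F s in at 0. dist (t s) t0 < e"
      by eventually_elim (use \<open>e > 0\<close> in \<open>simp add: dist_real_def\<close>)
  qed
  moreover have "t 0 = t0" by (simp add: t_def)
  moreover have "\<forall>\<^sub>F s in at 0. K s (t s) = 0"
    using near[of 1] by (simp add: eventually_conj_iff)
  ultimately show thesis using that[of t] by (simp add: isCont_def)
qed

section \<open>Arc length parametrizations\<close>

text \<open>
  The inverse of an antiderivative of the speed \<open>\<rho>\<close>. The positive lower bound of the speed makes this
  antiderivative unbounded in both directions, hence onto the whole line.
\<close>

lemma arc_length_reparametrization:
  fixes \<rho> :: "real \<Rightarrow> real"
  assumes cont: "\<And>r. isCont \<rho> r" and m: "m > 0" "\<And>r. \<rho> r \<ge> m"
  obtains \<mu> L where "\<mu> 0 = 0" "\<And>s. L (\<mu> s) = s" "\<And>r. \<mu> (L r) = r"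
    "\<And>s. (\<mu> has_real_derivative 1 / \<rho> (\<mu> s)) (at s)" "\<And>r. isCont L r"
proof -
  have "\<exists>F. \<forall>x::real. - \<infinity> < ereal x \<longrightarrow> ereal x < \<infinity> \<longrightarrow> (F has_vector_derivative \<rho> x) (at x)"
    by (rule einterval_antiderivative) (use cont in auto)
  then obtain F where F: "\<And>x. (F has_vector_derivative \<rho> x) (at x)" by auto
  define L where "L = (\<lambda>r. F r - F 0)"
  have Ld: "(L has_real_derivative \<rho> r) (at r)" for r
    using F[of r] unfolding L_def has_real_derivative_iff_has_vector_derivative
    by (simp add: has_vector_derivative_diff_const)
  have Lc: "isCont L r" for r using Ld by (rule DERIV_isCont)
  have pos: "\<rho> r > 0" for r using m(1) m(2)[of r] by simp
  have less: "L a < L b" if "a < b" for a b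
    using that by (rule DERIV_pos_imp_increasing) (use Ld pos in blast)
  then have "strict_mono L" by (simp add: strict_mono_def)
  then have inj: "inj L" by (rule strict_mono_imp_inj_on)
  have growth: "L a - m * a \<le> L b - m * b" if "a \<le> b" for a b
  proof (rule DERIV_nonneg_imp_nondecreasing[OF that])
    fix x
    have "((\<lambda>r. L r - m * r) has_real_derivative \<rho> x - m * 1) (at x)"
      by (intro DERIV_diff Ld DERIV_cmult DERIV_ident)
    then show "\<exists>y. ((\<lambda>r. L r - m * r) has_real_derivative y) (at x) \<and> 0 \<le> y"
      using m(2)[of x] by (intro exI[of _ "\<rho> x - m"]) simp
  qed
  have L0: "L 0 = 0" by (simp add: L_def)
  have "\<exists>r. L r = s" for s
  proof -
    let ?b = "\<bar>s\<bar> / m"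
    have "- ?b \<le> 0" "0 \<le> ?b" "m * ?b = \<bar>s\<bar>" using m by auto
    then have "L (- ?b) \<le> s" "s \<le> L ?b" using growth[of "- ?b" 0] growth[of 0 ?b] L0 by auto
    moreover have "continuous_on {- ?b..?b} L" using Lc by (simp add: continuous_at_imp_continuous_on)
    ultimately show ?thesis using IVT'[of L "- ?b" s ?b] \<open>- ?b \<le> 0\<close> \<open>0 \<le> ?b\<close> by auto
  qed
  then have surj: "surj L" by (metis surj_def)
  define \<mu> where "\<mu> = inv L"
  have L\<mu>: "L (\<mu> s) = s" for s using surj by (simp add: \<mu>_def surj_f_inv_f)
  have \<mu>L: "\<mu> (L r) = r" for r using inj by (simp add: \<mu>_def)
  have \<mu>c: "isCont \<mu> s" for s
    using isCont_inverse_function2[of "\<mu> s - 1" "\<mu> s" "\<mu> s + 1" \<mu> L] L\<mu> \<mu>L Lc by simp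
  have \<mu>d: "(\<mu> has_real_derivative 1 / \<rho> (\<mu> s)) (at s)" for s
    using DERIV_inverse_function[where f = L and g = \<mu> and x = s and a = "s - 1" and b = "s + 1", OF Ld] pos[of "\<mu> s"] L\<mu> \<mu>c
    by (simp add: inverse_eq_divide)
  show thesis
    using that[of \<mu> L] L\<mu> \<mu>L \<mu>d Lc \<mu>L[of 0] L0 by simp
qed

lemma unit_circle_angle:
  obtains t where "0 \<le> t" "t \<le> 2 * pi" "cos \<theta> = cos t" "sin \<theta> = sin t"
  using sincos_total_2pi_le[of "cos \<theta>" "sin \<theta>"] by auto

context curved_norm
begin

text \<open>
  Normalizing the vectors \<open>cos t *\<^sub>R e1 + sin t *\<^sub>R e2\<close> gives a positively oriented regular parametrization
  of the unit circle. Its speed depends only on \<open>cos t\<close> and \<open>sin t\<close>, hence is bounded below by its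
  minimum over one period, and the parametrization can be changed to unit speed on the whole line.
\<close>

lemma unit_circle_param_exists:
  assumes ind: "\<And>a b. a *\<^sub>R e1 + b *\<^sub>R e2 = 0 \<Longrightarrow> a = 0 \<and> b = 0"
  obtains \<phi> where "unit_circle_param N e1 e2 \<phi>"
proof -
  define w where "w = (\<lambda>t. cos t *\<^sub>R e1 + sin t *\<^sub>R e2)"
  define w' where "w' = (\<lambda>t. (- sin t) *\<^sub>R e1 + cos t *\<^sub>R e2)"
  have w0: "w t \<noteq> 0" for t
  proof
    assume "w t = 0"
    then have "cos t = 0" "sin t = 0" using ind[of "cos t" "sin t"] by (simp_all add: w_def)
    then show False using sin_cos_squared_add[of t] by simp
  qed
  have wd: "(w has_vector_derivative w' t) (at t)" for t
    unfolding w_def w'_def has_vector_derivative_def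
    by (auto intro!: derivative_eq_intros simp: algebra_simps)
  define i where "i = (\<lambda>t. inverse (N (w t)))"
  define m where "m = (\<lambda>t. i t * (G (w t) \<bullet> w' t) * i t)"
  have ipos: "i t > 0" for t using N_pos[OF w0] by (simp add: i_def)
  define \<beta> where "\<beta> = (\<lambda>t. i t *\<^sub>R w t)"
  define \<beta>' where "\<beta>' = (\<lambda>t. i t *\<^sub>R w' t + (- m t) *\<^sub>R w t)"
  have \<beta>d: "(\<beta> has_vector_derivative \<beta>' t) (at t)" for t
  proof -
    have "N (w t) \<noteq> 0" using w0 by simp
    then have "(i has_real_derivative - m t) (at t)"
      unfolding i_def m_def by (rule DERIV_inverse'[OF N_curve_has_derivative[OF wd w0]])
    then show ?thesis unfolding \<beta>_def \<beta>'_def by (rule has_vector_derivative_scaleR[OF _ wd])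
  qed
  have \<beta>1: "\<beta> t = (i t * cos t) *\<^sub>R e1 + (i t * sin t) *\<^sub>R e2" for t
    by (simp add: \<beta>_def w_def scaleR_add_right)
  have \<beta>'1: "\<beta>' t = (- i t * sin t - m t * cos t) *\<^sub>R e1 + (i t * cos t - m t * sin t) *\<^sub>R e2" for t
    by (simp add: \<beta>'_def w_def w'_def algebra_simps)
  have det: "(i t * cos t) * (i t * cos t - m t * sin t) - (i t * sin t) * (- i t * sin t - m t * cos t) = (i t)\<^sup>2" for t
  proof -
    have "(I * C) * (I * C - M * S) - (I * S) * (- I * S - M * C) = I\<^sup>2 * (C\<^sup>2 + S\<^sup>2)" for I C M S :: real
      by algebra
    then show ?thesis by simp
  qed
  have \<beta>'0: "\<beta>' t \<noteq> 0" for t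
  proof
    assume "\<beta>' t = 0"
    then have "- i t * sin t - m t * cos t = 0" "i t * cos t - m t * sin t = 0"
      using ind unfolding \<beta>'1 by blast+
    then have "(i t)\<^sup>2 = 0" using det[of t] by (simp only: mult_zero_right diff_zero)
    then show False using ipos[of t] by simp
  qed
  have wc: "isCont w t" "isCont w' t" for t unfolding w_def w'_def by (intro continuous_intros)+
  have ic: "isCont i t" for t
    unfolding i_def using w0 by (intro continuous_intros isCont_o2[OF wc(1)] N_continuous) simp
  have mc: "isCont m t" for t
    unfolding m_def by (intro continuous_intros ic wc isCont_o2[OF wc(1)] G_isCont w0)
  have \<beta>'c: "isCont \<beta>' t" for t
    unfolding \<beta>'_def by (intro continuous_intros ic wc mc)
  define \<rho> where "\<rho> = (\<lambda>t. N (\<beta>' t))"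
  have \<rho>c: "isCont \<rho> t" for t unfolding \<rho>_def by (rule isCont_o2[OF \<beta>'c N_continuous])
  have \<rho>pos: "\<rho> t > 0" for t using N_pos[OF \<beta>'0] by (simp add: \<rho>_def)
  have "continuous_on {0..2 * pi} \<rho>" using \<rho>c by (simp add: continuous_at_imp_continuous_on)
  then obtain t0 where t0: "\<And>t. t \<in> {0..2 * pi} \<Longrightarrow> \<rho> t0 \<le> \<rho> t"
    using continuous_attains_inf[of "{0..2 * pi}" \<rho>] by force
  have "\<rho> t0 \<le> \<rho> t" for t
  proof -
    obtain t' where t': "0 \<le> t'" "t' \<le> 2 * pi" "cos t = cos t'" "sin t = sin t'"
      by (rule unit_circle_angle)
    then have "\<rho> t = \<rho> t'" by (simp add: \<rho>_def \<beta>'_def m_def i_def w_def w'_def)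
    then show ?thesis using t0 t' by simp
  qed
  then obtain \<mu> L where \<mu>: "\<And>s. L (\<mu> s) = s" "\<And>r. \<mu> (L r) = r"
    "\<And>s. (\<mu> has_real_derivative 1 / \<rho> (\<mu> s)) (at s)"
    using arc_length_reparametrization[OF \<rho>c \<rho>pos[of t0]] by metis
  define \<phi> where "\<phi> = (\<lambda>s. \<beta> (\<mu> s))"
  define \<phi>' where "\<phi>' = (\<lambda>s. (1 / \<rho> (\<mu> s)) *\<^sub>R \<beta>' (\<mu> s))"
  have \<mu>c: "isCont \<mu> s" for s using \<mu>(3) by (rule DERIV_isCont)
  have \<phi>d: "(\<phi> has_vector_derivative \<phi>' s) (at s)" for s
    using vector_diff_chain_at[OF \<mu>(3)[unfolded has_real_derivative_iff_has_vector_derivative] \<beta>d]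
    unfolding \<phi>_def \<phi>'_def o_def .
  then have vd: "vector_derivative \<phi> (at s) = \<phi>' s" for s by (rule vector_derivative_at)
  have "isCont \<phi>' s" for s
    unfolding \<phi>'_def using \<rho>pos[of "\<mu> s"]
    by (intro continuous_intros isCont_o2[OF \<mu>c \<rho>c] isCont_o2[OF \<mu>c \<beta>'c]) simp
  then have C1: "\<phi> C1_differentiable_on UNIV"
    unfolding C1_differentiable_on_def using \<phi>d
    by (intro exI[of _ \<phi>']) (simp add: continuous_at_imp_continuous_on)
  have "range \<phi> = range \<beta>"
    unfolding \<phi>_def using \<mu>(2) by (metis (no_types, lifting) image_cong image_image surjI)
  also have "range \<beta> = unit_sphere N \<inter> span {e1, e2}"
  proof (intro equalityI subsetI)
    fix x assume "x \<in> range \<beta>"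
    then obtain t where t: "x = \<beta> t" by auto
    have "N x = 1" using N_normalize[OF w0[of t]] by (simp add: t \<beta>_def i_def)
    moreover have "x \<in> span {e1, e2}"
      unfolding t \<beta>1 by (intro span_add span_scale span_base) auto
    ultimately show "x \<in> unit_sphere N \<inter> span {e1, e2}" by (simp add: unit_sphere_def)
  next
    fix x assume "x \<in> unit_sphere N \<inter> span {e1, e2}"
    then have x: "N x = 1" "x \<in> span {e1, e2}" by (auto simp: unit_sphere_def)
    then obtain a b where ab: "x = a *\<^sub>R e1 + b *\<^sub>R e2"
      by (auto simp: span_insert span_singleton algebra_simps) 
    define r where "r = sqrt (a\<^sup>2 + b\<^sup>2)"
    have "a \<noteq> 0 \<or> b \<noteq> 0" using x(1) ab by auto
    then have r: "r > 0" "r\<^sup>2 = a\<^sup>2 + b\<^sup>2"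
      by (auto simp: r_def sum_power2_gt_zero_iff)
    then have "(a / r)\<^sup>2 + (b / r)\<^sup>2 = 1"
      by (simp only: power_divide add_divide_distrib[symmetric] r(2)[symmetric]) (use r(1) in simp)
    then obtain t where t: "a / r = cos t" "b / r = sin t" using sincos_total_2pi_le by blast
    have xr: "x = r *\<^sub>R w t" using r by (simp add: ab w_def t[symmetric] scaleR_add_right)
    then have "r * N (w t) = 1" using x(1) r by (simp add: N_scale)
    then have "i t = r" by (simp add: i_def) (metis inverse_unique mult.commute)
    then have "x = \<beta> t" using xr by (simp add: \<beta>_def)
    then show "x \<in> range \<beta>" by (rule range_eqI)
  qed
  finally have rng: "range \<phi> = unit_sphere N \<inter> span {e1, e2}" .
  have "N (\<phi>' s) = 1" for s
    using \<rho>pos[of "\<mu> s"] \<beta>'0[of "\<mu> s"] by (simp add: \<phi>'_def N_scale \<rho>_def)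
  moreover have "positive_basis e1 e2 (\<phi> s) (\<phi>' s)" for s
  proof -
    let ?t = "\<mu> s"
    let ?c = "1 / \<rho> ?t"
    have "\<phi>' s = (?c * (- i ?t * sin ?t - m ?t * cos ?t)) *\<^sub>R e1 + (?c * (i ?t * cos ?t - m ?t * sin ?t)) *\<^sub>R e2"
      unfolding \<phi>'_def \<beta>'1 by (simp add: scaleR_add_right)
    moreover have "(i ?t * cos ?t) * (?c * (i ?t * cos ?t - m ?t * sin ?t))
        - (i ?t * sin ?t) * (?c * (- i ?t * sin ?t - m ?t * cos ?t)) = ?c * (i ?t)\<^sup>2"
      unfolding det[symmetric] by (simp only: algebra_simps)
    moreover have "?c * (i ?t)\<^sup>2 > 0" using \<rho>pos[of ?t] ipos[of ?t] by simp
    ultimately show ?thesis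
      unfolding positive_basis_def \<phi>_def using \<beta>1[of ?t] by metis
  qed
  ultimately have "unit_circle_param N e1 e2 \<phi>"
    unfolding unit_circle_param_def using C1 rng vd by simp
  then show thesis by (rule that)
qed

end

section \<open>Regular level curves\<close>

text \<open>
  The map \<open>\<Psi> u = (u - u0) + (h u - h' u0 (u - u0)) *\<^sub>R h2\<close> has the identity as its derivative at \<open>u0\<close> and
  satisfies \<open>h' u0 (\<Psi> u) = h u\<close>. Its local inverse hence straightens the level set to the line spanned by
  \<open>h1\<close>.
\<close>

lemma level_curve:
  fixes h :: "'a::euclidean_space \<Rightarrow> real"
  assumes D: "open D" "u0 \<in> D" and hd: "\<And>u. u \<in> D \<Longrightarrow> (h has_derivative h' u) (at u)"
    and hc: "\<And>v. continuous_on D (\<lambda>u. h' u v)" and h0: "h u0 = 0"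
    and ker: "\<And>v. h' u0 v = 0 \<longleftrightarrow> v \<in> span {h1}" and h1: "h1 \<noteq> 0" and h2: "h' u0 h2 = 1"
  obtains \<delta> X \<sigma> \<tau> d where "\<delta> > 0" "open X" "u0 \<in> X" "X \<subseteq> D" "\<sigma> 0 = u0"
    "homeomorphism {-\<delta><..<\<delta>} {u \<in> X. h u = 0} \<sigma> \<tau>"
    "\<And>r. r \<in> {-\<delta><..<\<delta>} \<Longrightarrow> (\<sigma> has_vector_derivative d r) (at r)"
    "continuous_on {-\<delta><..<\<delta>} d" "d 0 = h1" "\<And>r. r \<in> {-\<delta><..<\<delta>} \<Longrightarrow> d r \<noteq> 0"
proof -
  let ?m = "h' u0"
  have m: "linear ?m" using hd[OF D(2)] by (rule has_derivative_linear)
  have bl: "bounded_linear (h' u)" if "u \<in> D" for u using hd[OF that] by (rule has_derivative_bounded_linear)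
  define D2 where "D2 = D \<inter> (\<lambda>u. h' u h2) -` (- {0})"
  have D2: "open D2" "u0 \<in> D2" "D2 \<subseteq> D"
    using D h2 continuous_open_preimage[OF hc[of h2] D(1)] by (auto simp: D2_def)
  define \<Psi> where "\<Psi> = (\<lambda>u. (u - u0) + (h u - ?m (u - u0)) *\<^sub>R h2)"
  define \<Psi>' where "\<Psi>' = (\<lambda>u. Blinfun (\<lambda>v. v + (h' u v - ?m v) *\<^sub>R h2))"
  have app: "blinfun_apply (\<Psi>' u) = (\<lambda>v. v + (h' u v - ?m v) *\<^sub>R h2)" if "u \<in> D" for u
    unfolding \<Psi>'_def
    by (intro bounded_linear_Blinfun_apply bounded_linear_add bounded_linear_ident
        bounded_linear_scaleR_left[THEN bounded_linear_compose] bounded_linear_sub bl that D)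
  have \<Psi>d: "(\<Psi> has_derivative blinfun_apply (\<Psi>' u)) (at u)" if "u \<in> D2" for u
  proof -
    have u: "u \<in> D" using that D2 by auto
    have id: "((\<lambda>u. u - u0) has_derivative (\<lambda>v. v)) (at u)"
      using has_derivative_diff[OF has_derivative_ident has_derivative_const[of u0]] by simp
    have "(\<Psi> has_derivative (\<lambda>v. v + (h' u v - ?m v) *\<^sub>R h2)) (at u)"
      unfolding \<Psi>_def
      by (intro has_derivative_add id has_derivative_scaleR_left has_derivative_diff hd[OF u]
          has_derivative_compose[OF id linear_has_derivative[OF m]])
    then show ?thesis by (simp add: app[OF u])
  qed
  have \<Psi>'c: "continuous_on D2 \<Psi>'"
  proof (rule continuous_on_blinfun_componentwise)
    fix b :: 'a
    have "continuous_on D2 (\<lambda>u. b + (h' u b - ?m b) *\<^sub>R h2)"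
      by (intro continuous_intros continuous_on_subset[OF hc D2(3)])
    then show "continuous_on D2 (\<lambda>u. blinfun_apply (\<Psi>' u) b)"
    proof (rule continuous_on_eq)
      show "b + (h' u b - ?m b) *\<^sub>R h2 = blinfun_apply (\<Psi>' u) b" if "u \<in> D2" for u
        using app[of u] that D2 by auto
    qed
  qed
  have "\<Psi>' u0 = id_blinfun"
    by (rule blinfun_eqI) (simp add: app[OF D(2)])
  then have "id_blinfun o\<^sub>L \<Psi>' u0 = id_blinfun" by (simp add: blinfun_eqI)
  from inverse_function_theorem[OF D2(1) \<Psi>d \<Psi>'c D2(2) this]
  obtain U' V g g' where U': "open U'" "U' \<subseteq> D2" "u0 \<in> U'" and V: "open V" "\<Psi> u0 \<in> V"
    and hom: "homeomorphism U' V \<Psi> g"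
    and gd: "\<And>y. y \<in> V \<Longrightarrow> (g has_derivative (g' y)) (at y)"
    and g'1: "\<And>y. y \<in> V \<Longrightarrow> g' y = inv (blinfun_apply (\<Psi>' (g y)))"
    and g'2: "\<And>y. y \<in> V \<Longrightarrow> bij (blinfun_apply (\<Psi>' (g y)))" by metis
  have \<Psi>0: "\<Psi> u0 = 0" by (simp add: \<Psi>_def h0 linear_0[OF m])
  then obtain e where e: "e > 0" "ball 0 e \<subseteq> V" using V open_contains_ball by metis
  have m\<Psi>: "?m (\<Psi> u) = h u" for u
    by (simp add: \<Psi>_def linear_add[OF m] linear_scale[OF m] h2)
  have mh1: "?m h1 = 0" using ker[of h1] by (simp add: span_base)
  define \<delta> where "\<delta> = e / norm h1"
  have \<delta>: "\<delta> > 0" using e h1 by (simp add: \<delta>_def)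
  have ball: "r *\<^sub>R h1 \<in> ball 0 e \<longleftrightarrow> r \<in> {-\<delta><..<\<delta>}" for r
  proof -
    have "r *\<^sub>R h1 \<in> ball 0 e \<longleftrightarrow> \<bar>r\<bar> < \<delta>" using h1 by (simp add: \<delta>_def field_simps)
    then show ?thesis by auto
  qed
  define X where "X = U' \<inter> \<Psi> -` ball 0 e"
  have \<Psi>c: "continuous_on U' \<Psi>" using hom by (rule homeomorphism_cont1)
  have X: "open X" "u0 \<in> X" "X \<subseteq> D"
    using continuous_open_preimage[OF \<Psi>c U'(1) open_ball] U' \<Psi>0 e D2(3) by (auto simp: X_def)
  define \<sigma> where "\<sigma> = (\<lambda>r. g (r *\<^sub>R h1))"
  define \<tau> where "\<tau> = (\<lambda>u. (\<Psi> u \<bullet> h1) / (h1 \<bullet> h1))"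
  have g\<Psi>: "g (\<Psi> u) = u" if "u \<in> U'" for u using hom that by (rule homeomorphism_apply1)
  have \<Psi>g: "\<Psi> (g y) = y" if "y \<in> V" for y using hom that by (rule homeomorphism_apply2)
  have gU: "g y \<in> U'" if "y \<in> V" for y using homeomorphism_image2[OF hom] that by blast
  have inV: "r *\<^sub>R h1 \<in> V" if "r \<in> {-\<delta><..<\<delta>}" for r using ball[of r] that e by blast
  have \<Psi>\<sigma>: "\<Psi> (\<sigma> r) = r *\<^sub>R h1" if "r \<in> {-\<delta><..<\<delta>}" for r
    using \<Psi>g[OF inV[OF that]] by (simp add: \<sigma>_def)
  have \<sigma>X: "\<sigma> r \<in> {u \<in> X. h u = 0}" if "r \<in> {-\<delta><..<\<delta>}" for r
  proof -
    have "\<sigma> r \<in> U'" using gU[OF inV[OF that]] by (simp add: \<sigma>_def)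
    then have "\<sigma> r \<in> X" using \<Psi>\<sigma>[OF that] ball[of r] that by (simp add: X_def)
    moreover have "h (\<sigma> r) = 0" using m\<Psi>[of "\<sigma> r"] \<Psi>\<sigma>[OF that] by (simp add: linear_scale[OF m] mh1)
    ultimately show ?thesis by simp
  qed
  have \<tau>\<sigma>: "\<tau> (\<sigma> r) = r" if "r \<in> {-\<delta><..<\<delta>}" for r
    using \<Psi>\<sigma>[OF that] h1 by (simp add: \<tau>_def)
  have \<sigma>\<tau>: "\<tau> u \<in> {-\<delta><..<\<delta>} \<and> \<sigma> (\<tau> u) = u" if u: "u \<in> X" "h u = 0" for u
  proof -
    have "?m (\<Psi> u) = 0" using m\<Psi> u by simp
    then obtain r where r: "\<Psi> u = r *\<^sub>R h1" using ker by (auto simp: span_singleton)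
    then have \<tau>u: "\<tau> u = r" using h1 by (simp add: \<tau>_def)
    have "r *\<^sub>R h1 \<in> ball 0 e" using u(1) r by (simp add: X_def)
    moreover have "\<sigma> r = u" using g\<Psi>[of u] u(1) r by (simp add: \<sigma>_def X_def)
    ultimately show ?thesis using ball \<tau>u by simp
  qed
  have \<sigma>c: "continuous_on {-\<delta><..<\<delta>} \<sigma>"
    unfolding \<sigma>_def
    by (rule continuous_on_compose2[OF homeomorphism_cont2[OF hom]]) (use inV in \<open>auto intro!: continuous_intros\<close>)
  have H: "homeomorphism {-\<delta><..<\<delta>} {u \<in> X. h u = 0} \<sigma> \<tau>"
  proof (rule homeomorphismI)
    show "continuous_on {u \<in> X. h u = 0} \<tau>"
      unfolding \<tau>_def using h1
      by (intro continuous_intros continuous_on_subset[OF \<Psi>c]) (auto simp: X_def)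
  qed (use \<sigma>c \<sigma>X \<sigma>\<tau> \<tau>\<sigma> in auto)
  \<comment> \<open>The velocity of \<open>\<sigma>\<close> differs from \<open>h1\<close> by a multiple of \<open>h2\<close> and lies in the kernel of the
    derivative of \<open>h\<close>; this formula also shows its continuity.\<close>
  define c where "c = (\<lambda>r. - h' (\<sigma> r) h1 / h' (\<sigma> r) h2)"
  define d where "d = (\<lambda>r. h1 + c r *\<^sub>R h2)"
  have \<sigma>d: "(\<sigma> has_vector_derivative d r) (at r)" if r: "r \<in> {-\<delta><..<\<delta>}" for r
  proof -
    let ?w = "g' (r *\<^sub>R h1) h1"
    have "((\<lambda>r. r *\<^sub>R h1) has_derivative (\<lambda>s. s *\<^sub>R h1)) (at r)"
      by (intro has_derivative_scaleR_left has_derivative_ident)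
    from has_derivative_compose[OF this gd[OF inV[OF r]]]
    have "(\<sigma> has_derivative (\<lambda>s. g' (r *\<^sub>R h1) (s *\<^sub>R h1))) (at r)" unfolding \<sigma>_def .
    then have 1: "(\<sigma> has_vector_derivative ?w) (at r)"
      unfolding has_vector_derivative_def
      by (simp add: linear_scale[OF has_derivative_linear[OF gd[OF inV[OF r]]]])
    have \<sigma>D: "\<sigma> r \<in> D" "\<sigma> r \<in> D2" using \<sigma>X[OF r] X U' by (auto simp: X_def)
    then have lin: "linear (h' (\<sigma> r))" using bl by (simp add: bounded_linear.linear)
    have nz: "h' (\<sigma> r) h2 \<noteq> 0" using \<sigma>D(2) by (simp add: D2_def)
    have "blinfun_apply (\<Psi>' (\<sigma> r)) ?w = h1"
      using g'1[OF inV[OF r]] g'2[OF inV[OF r]] by (simp add: \<sigma>_def bij_is_surj surj_f_inv_f)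
    then have "?w + (h' (\<sigma> r) ?w - ?m ?w) *\<^sub>R h2 = h1" by (simp add: app[OF \<sigma>D(1)])
    then have w: "?w = h1 + (?m ?w - h' (\<sigma> r) ?w) *\<^sub>R h2"
      by (simp add: algebra_simps)
    define k where "k = ?m ?w - h' (\<sigma> r) ?w"
    have w: "?w = h1 + k *\<^sub>R h2" using w by (simp add: k_def)
    have "?m ?w = k" using w by (simp add: linear_add[OF m] linear_scale[OF m] mh1 h2)
    then have "h' (\<sigma> r) ?w = 0" by (simp add: k_def)
    then have "h' (\<sigma> r) h1 + k * h' (\<sigma> r) h2 = 0" using w by (simp add: linear_add[OF lin] linear_scale[OF lin])
    then have "k = c r" using nz by (simp add: c_def field_simps)
    then show ?thesis using 1 w by (simp add: d_def)
  qed
  have \<sigma>D2: "\<sigma> r \<in> D2" if "r \<in> {-\<delta><..<\<delta>}" for r using \<sigma>X[OF that] U' by (auto simp: X_def)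
  have hvc: "continuous_on {-\<delta><..<\<delta>} (\<lambda>r. h' (\<sigma> r) v)" for v
    by (rule continuous_on_compose2[OF hc \<sigma>c]) (use \<sigma>D2 D2 in auto)
  have dc: "continuous_on {-\<delta><..<\<delta>} d"
    unfolding d_def c_def using \<sigma>D2 by (intro continuous_intros hvc) (auto simp: D2_def)
  have \<sigma>0: "\<sigma> 0 = u0" using g\<Psi>[OF U'(3)] \<Psi>0 by (simp add: \<sigma>_def)
  have d0: "d 0 = h1" by (simp add: d_def c_def \<sigma>0 mh1)
  have dnz: "d r \<noteq> 0" for r
  proof
    assume 0: "d r = 0"
    then have "?m (d r) = 0" by (simp add: linear_0[OF m])
    then have "c r = 0" by (simp add: d_def linear_add[OF m] linear_scale[OF m] mh1 h2)
    then show False using 0 h1 by (simp add: d_def)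
  qed
  show thesis using that[OF \<delta> X \<sigma>0 H \<sigma>d dc d0 dnz] .
qed

section \<open>Circular curvature of plane curves\<close>

lemma has_vector_derivative_in_subspace:
  fixes c :: "real \<Rightarrow> 'a::euclidean_space"
  assumes c: "(c has_vector_derivative v) (at s)" and H: "subspace H"
    and ev: "\<forall>\<^sub>F r in at s. c r - q \<in> H" and s: "c s - q \<in> H"
  shows "v \<in> H"
proof (rule Lim_in_closed_set[OF closed_subspace[OF H]])
  show "((\<lambda>r. (c r - c s) /\<^sub>R (r - s)) \<longlongrightarrow> v) (at s)"
    using c by (simp add: has_vector_derivative_iff_slope)
  show "\<forall>\<^sub>F r in at s. (c r - c s) /\<^sub>R (r - s) \<in> H"
    using ev
  proof eventually_elim
    case (elim r)
    have "(c r - q) - (c s - q) \<in> H" by (rule subspace_diff[OF H elim s])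
    then have "c r - c s \<in> H" by simp
    then show ?case using H by (simp add: subspace_scale)
  qed
qed simp

context curved_norm
begin

lemma transversal_independent:
  assumes x: "N x = 1" and Y: "Y \<noteq> 0" "G x \<bullet> Y = 0" and ab: "a *\<^sub>R x + b *\<^sub>R Y = 0"
  shows "a = 0 \<and> b = 0"
proof -
  have "a = G x \<bullet> (a *\<^sub>R x + b *\<^sub>R Y)"
    using G_self[OF unit_nonzero[OF x]] x Y by (simp add: inner_add_right)
  then have "a = 0" using ab by simp
  then show ?thesis using ab Y by simp
qed

lemma transversal_dim:
  assumes x: "N x = 1" and Y: "Y \<noteq> 0" "G x \<bullet> Y = 0"
  shows "dim (span {x, Y}) = 2"
proof -
  have "x \<notin> span {Y}"
  proof
    assume "x \<in> span {Y}"
    then obtain b where "x = b *\<^sub>R Y" by (auto simp: span_singleton)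
    then have "1 *\<^sub>R x + (- b) *\<^sub>R Y = 0" by simp
    from transversal_independent[OF x Y this] show False by simp
  qed
  then show ?thesis using Y by (simp add: dim_insert)
qed

text \<open>
  Coordinates with respect to \<open>x\<close>, \<open>Y\<close> are unique, so orientation is the sign of their determinant.
\<close>

lemma positive_basis_transversal:
  assumes x: "N x = 1" and Y: "Y \<noteq> 0" "G x \<bullet> Y = 0"
  shows "positive_basis x Y (a *\<^sub>R x + b *\<^sub>R Y) (c *\<^sub>R x + d *\<^sub>R Y) \<longleftrightarrow> a * d - b * c > 0"
proof -
  have uniq: "a = a' \<and> b = b'" if "a *\<^sub>R x + b *\<^sub>R Y = a' *\<^sub>R x + b' *\<^sub>R Y" for a b a' b'
    using transversal_independent[OF x Y, of "a - a'" "b - b'"] that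
    by (simp add: algebra_simps)
  show ?thesis
  proof
    assume "positive_basis x Y (a *\<^sub>R x + b *\<^sub>R Y) (c *\<^sub>R x + d *\<^sub>R Y)"
    then obtain v1 v2 w1 w2 where *: "a *\<^sub>R x + b *\<^sub>R Y = v1 *\<^sub>R x + v2 *\<^sub>R Y"
      "c *\<^sub>R x + d *\<^sub>R Y = w1 *\<^sub>R x + w2 *\<^sub>R Y" "v1 * w2 - v2 * w1 > 0"
      unfolding positive_basis_def by blast
    show "a * d - b * c > 0" using uniq[OF *(1)] uniq[OF *(2)] *(3) by simp
  next
    assume "a * d - b * c > 0"
    then show "positive_basis x Y (a *\<^sub>R x + b *\<^sub>R Y) (c *\<^sub>R x + d *\<^sub>R Y)"
      unfolding positive_basis_def by blast
  qed
qed

lemma span_pair_obtain: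
  assumes "z \<in> span {x, y}"
  obtains a b where "z = a *\<^sub>R x + b *\<^sub>R y"
  using assms by (auto simp: span_insert span_singleton algebra_simps)

lemma unit_circle_velocity:
  assumes \<phi>: "unit_circle_param N x Y \<phi>"
  shows "(\<phi> has_vector_derivative vector_derivative \<phi> (at t)) (at t)"
    and "isCont (\<lambda>t. vector_derivative \<phi> (at t)) t"
    and "N (\<phi> t) = 1" and "\<phi> t \<in> span {x, Y}"
    and "G (\<phi> t) \<bullet> vector_derivative \<phi> (at t) = 0"
    and "vector_derivative \<phi> (at t) \<in> span {x, Y}"
proof -
  have C1: "\<phi> C1_differentiable_on UNIV" and rng: "range \<phi> = unit_sphere N \<inter> span {x, Y}"
    using \<phi> by (simp_all add: unit_circle_param_def)
  show d: "(\<phi> has_vector_derivative vector_derivative \<phi> (at t)) (at t)"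
    using C1 by (simp add: C1_differentiable_on_eq vector_derivative_works)
  show "isCont (\<lambda>t. vector_derivative \<phi> (at t)) t"
    using C1 by (simp add: C1_differentiable_on_eq continuous_on_eq_continuous_at)
  have mem: "N (\<phi> t) = 1 \<and> \<phi> t \<in> span {x, Y}" for t
    using rng rangeI[of \<phi> t] by (simp add: unit_sphere_def)
  then show "N (\<phi> t) = 1" "\<phi> t \<in> span {x, Y}" by auto
  have "((\<lambda>t. N (\<phi> t)) has_real_derivative G (\<phi> t) \<bullet> vector_derivative \<phi> (at t)) (at t)"
    using N_curve_has_derivative[OF d] mem unit_nonzero by blast
  moreover have "(\<lambda>t. N (\<phi> t)) = (\<lambda>t. 1)" using mem by auto
  ultimately show "G (\<phi> t) \<bullet> vector_derivative \<phi> (at t) = 0"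
    using DERIV_unique[OF _ DERIV_const[of 1 "at t"]] by metis
  show "vector_derivative \<phi> (at t) \<in> span {x, Y}"
    by (rule has_vector_derivative_in_subspace[OF d subspace_span, of 0]) (use mem in auto)
qed

text \<open>
  Here \<open>a\<close> stands for the restriction to the curve of a normal field of a surface containing \<open>\<gamma>\<close>. Uniqueness:
  the Birkhoff normal of \<open>\<gamma>\<close> in the plane starts at \<open>x\<close> by strict convexity, so its angle function
  satisfies the hypotheses of \<open>normal_speeds_agree\<close>. Existence: on a unit speed parametrization \<open>\<phi>\<close> of the
  unit circle, a point whose tangent direction is \<open>v s\<close> is a zero of \<open>\<tau> \<mapsto> G (\<phi> \<tau>) \<bullet> v s\<close>, simple at \<open>s = 0\<close>
  by curvature. The selected zeros give a continuous angle function, which is differentiable by the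
  same comparison.
\<close>

lemma has_circular_curvature_iff:
  assumes strict: "\<And>a b. a \<noteq> b \<Longrightarrow> \<not> closed_segment a b \<subseteq> unit_sphere N"
    and x: "N x = 1" and Y: "N Y = 1" "G x \<bullet> Y = 0"
    and \<gamma>: "\<epsilon> > 0" "\<And>s. \<bar>s\<bar> < \<epsilon> \<Longrightarrow> (\<gamma> has_vector_derivative v s) (at s)"
    and v: "isCont v 0" "v 0 = Y" "\<And>s. \<bar>s\<bar> < \<epsilon> \<Longrightarrow> N (v s) = 1 \<and> v s \<in> span {x, Y}"
    and a: "(a has_vector_derivative \<kappa> *\<^sub>R Y) (at 0)" "a 0 = x"
    and orth: "\<forall>\<^sub>F s in at 0. G (a s) \<bullet> v s = 0"
  shows "has_circular_curvature N x Y \<gamma> 0 k \<longleftrightarrow> k = \<kappa>"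
proof -
  have Y0: "Y \<noteq> 0" and x0: "x \<noteq> 0" using Y x by auto
  let ?H = "span {x, Y}"
  have vd: "vector_derivative \<gamma> (at s) = v s" if "\<bar>s\<bar> < \<epsilon>" for s
    using \<gamma>(2)[OF that] by (rule vector_derivative_at)
  have small: "\<forall>\<^sub>F s in at (0::real). \<bar>s\<bar> < e" if "e > 0" for e
    unfolding eventually_at using that by (intro exI[of _ e]) (simp add: dist_real_def)
  have kernel: "G y \<bullet> w = 0" if "birkhoff_orth_in N ?H y (span {w})" "N y = 1" for y w
    using birkhoff_orth_in_imp_kernel[OF that subspace_span] span_base[of w "{w}"] by blast
  have uniq: "k = \<kappa>" if "has_circular_curvature N x Y \<gamma> 0 k" for k
  proof -
    from that obtain \<phi> \<nu> t e where e: "e > 0" and \<phi>: "unit_circle_param N x Y \<phi>"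
      and circ: "\<forall>s\<in>{0-e<..<0+e}. \<nu> s \<in> unit_sphere N \<and>
           birkhoff_orth_in N ?H (\<nu> s) (span {vector_derivative \<gamma> (at s)}) \<and>
           positive_basis x Y (\<nu> s) (vector_derivative \<gamma> (at s)) \<and>
           \<nu> s = \<phi> (t s) \<and> vector_derivative \<phi> (at (t s)) = vector_derivative \<gamma> (at s)"
      and td: "(t has_real_derivative k) (at 0)"
      unfolding has_circular_curvature_def by blast
    have orth': "G (\<phi> (t s)) \<bullet> v s = 0" if "\<bar>s\<bar> < e" "\<bar>s\<bar> < \<epsilon>" for s
    proof -
      have "s \<in> {0-e<..<0+e}" using that by auto
      from bspec[OF circ this] that vd[of s] kernel[of "\<nu> s" "v s"] show ?thesis
        by (auto simp: unit_sphere_def)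
    qed
    have 0: "N (\<phi> (t 0)) = 1" "positive_basis x Y (\<phi> (t 0)) Y" "vector_derivative \<phi> (at (t 0)) = Y"
      using circ[rule_format, of 0] e vd[of 0] \<gamma>(1) v(2) by (auto simp: unit_sphere_def)
    have \<phi>0: "\<phi> (t 0) = x"
    proof -
      obtain c b where cb: "\<phi> (t 0) = c *\<^sub>R x + b *\<^sub>R Y"
        using unit_circle_velocity(4)[OF \<phi>] by (rule span_pair_obtain)
      then have "c > 0"
        using positive_basis_transversal[OF x Y0 Y(2), of c b 0 1] 0(2) by simp
      moreover have "G (\<phi> (t 0)) \<bullet> Y = 0" using orth'[of 0] e \<gamma>(1) v(2) by simp
      ultimately show ?thesis
        using oriented_birkhoff_normal_unique[OF strict x Y(2) 0(1) _ cb] by blast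
    qed
    have "(\<phi> has_vector_derivative Y) (at (t 0))" using unit_circle_velocity(1)[OF \<phi>, of "t 0"] 0(3) by simp
    moreover have "\<forall>\<^sub>F s in at 0. G (a s) \<bullet> v s = 0 \<and> G (\<phi> (t s)) \<bullet> v s = 0"
      using orth small[OF e] small[OF \<gamma>(1)] by eventually_elim (use orth' in blast)
    ultimately have "(t has_real_derivative \<kappa>) (at 0)"
      using normal_speeds_agree[where \<phi> = \<phi> and t = t and a = a and v = v, OF x Y0 Y(2) a _ \<phi>0 DERIV_isCont[OF td] v(1,2)] by blast
    with td show ?thesis by (rule DERIV_unique)
  qed
  have "has_circular_curvature N x Y \<gamma> 0 \<kappa>"
  proof -
    obtain \<phi> where \<phi>: "unit_circle_param N x Y \<phi>"
      using unit_circle_param_exists[of x Y] transversal_independent[OF x Y0 Y(2)] by blast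
    note vel = unit_circle_velocity[OF \<phi>]
    let ?w = "\<lambda>t. vector_derivative \<phi> (at t)"
    have pos: "positive_basis x Y (\<phi> t) (?w t)" "N (?w t) = 1" for t
      using \<phi> by (simp_all add: unit_circle_param_def)
    have "x \<in> unit_sphere N \<inter> ?H" using x by (simp add: unit_sphere_def span_base)
    then obtain t0 where t0: "\<phi> t0 = x"
      using \<phi> unfolding unit_circle_param_def by (metis imageE)
    have w0: "?w t0 = Y"
    proof -
      obtain c b where cb: "?w t0 = c *\<^sub>R x + b *\<^sub>R Y"
        using vel(6) by (rule span_pair_obtain)
      have "G x \<bullet> ?w t0 = 0" using vel(5)[of t0] t0 by simp
      then have "c = 0" using G_self[OF x0] x Y by (simp add: cb inner_add_right)
      then have "b > 0" using pos(1)[of t0] positive_basis_transversal[OF x Y0 Y(2), of 1 0 c b] by (simp add: t0 cb)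
      moreover have "\<bar>b\<bar> = 1" using pos(2)[of t0] Y \<open>c = 0\<close> by (simp add: cb N_scale)
      ultimately show ?thesis using cb \<open>c = 0\<close> by simp
    qed
    define K where "K = (\<lambda>s \<tau>. G (\<phi> \<tau>) \<bullet> v s)"
    have Gc: "isCont (\<lambda>\<tau>. G (\<phi> \<tau>)) \<tau>" for \<tau>
      by (rule isCont_o2[OF has_vector_derivative_continuous[OF vel(1)] G_isCont[OF unit_nonzero[OF vel(3)]]])
    have K0: "K 0 t0 = 0" using Y v t0 by (simp add: K_def)
    have Kd: "(K 0 has_real_derivative frechet_derivative G (at x) Y \<bullet> Y) (at t0)"
    proof -
      have Gd: "(G has_derivative frechet_derivative G (at x)) (at (\<phi> t0))"
        using G_differentiable[OF x0] t0 frechet_derivative_works by metis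
      from has_derivative_inner_left[OF has_derivative_compose[OF vel(1)[unfolded has_vector_derivative_def] Gd], of Y]
      show ?thesis
        unfolding K_def has_field_derivative_def
        by (simp add: v w0 linear_scale[OF has_derivative_linear[OF Gd]] mult.commute[of _ "_ \<bullet> _"])
    qed
    obtain t where t: "t 0 = t0" "isCont t 0" "\<forall>\<^sub>F s in at 0. K s (t s) = 0"
    proof (rule simple_zero_selection[where K = K, OF K0 Kd])
      show "frechet_derivative G (at x) Y \<bullet> Y \<noteq> 0" using G_nondegenerate[OF x Y0 Y(2)] .
      show "isCont (\<lambda>s. K s \<tau>) 0" for \<tau> unfolding K_def using v(1) by (intro continuous_intros)
      have "continuous_on UNIV (K s)" for s
        unfolding K_def using Gc by (intro continuous_intros) (simp add: continuous_at_imp_continuous_on)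
      then show "\<forall>\<^sub>F s in at 0. continuous_on UNIV (K s)" by simp
    qed (rule that)
    \<comment> \<open>The two unit vectors \<open>?w (t s)\<close> and \<open>v s\<close> are parallel, and continuity excludes that they are
      opposite.\<close>
    have "isCont (\<lambda>s. ?w (t s)) 0" using t(1) isCont_o2[OF t(2) vel(2)] by simp
    then have "isCont (\<lambda>s. ?w (t s) + v s) 0" using v(1) by (intro continuous_intros)
    moreover have "?w (t 0) + v 0 \<noteq> 0" using t w0 v Y0 by (simp add: scaleR_2[symmetric])
    ultimately have "\<forall>\<^sub>F s in at 0. ?w (t s) + v s \<noteq> 0"
      unfolding isCont_def by (rule tendsto_imp_eventually_ne)
    then have ev: "\<forall>\<^sub>F s in at 0. ?w (t s) = v s"
      using t(3) small[OF \<gamma>(1)]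
    proof eventually_elim
      case (elim s)
      have vs: "N (v s) = 1" "v s \<in> ?H" using v(3) elim by auto
      have wt: "?w (t s) \<noteq> 0" using pos(2) unit_nonzero by blast
      have B: "birkhoff_orth_in N ?H (\<phi> (t s)) (span {?w (t s)})"
        using kernel_imp_birkhoff_orth_in[OF vel(3,4) subspace_span transversal_dim[OF x Y0 Y(2)] vel(6) wt vel(5)] .
      have "v s \<in> span {?w (t s)}"
        unfolding birkhoff_orth_in_imp_kernel[OF B vel(3) subspace_span]
        using vs elim by (simp add: K_def)
      then obtain b where b: "v s = b *\<^sub>R ?w (t s)" by (auto simp: span_singleton)
      then have "\<bar>b\<bar> = 1" using vs(1) pos(2) by (simp add: N_scale)
      moreover have "b \<noteq> -1" using elim(1) b by auto
      ultimately have "b = 1" by linarith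
      then show ?case using b by simp
    qed
    then obtain e where e: "e > 0" "\<And>s. s \<noteq> 0 \<Longrightarrow> \<bar>s\<bar> < e \<Longrightarrow> ?w (t s) = v s"
      unfolding eventually_at by (auto simp: dist_real_def)
    have wv: "?w (t s) = v s" if "\<bar>s\<bar> < e" for s
      using e(2)[of s] that t w0 v by (cases "s = 0") auto
    have "\<forall>\<^sub>F s in at 0. G (a s) \<bullet> v s = 0 \<and> G (\<phi> (t s)) \<bullet> v s = 0"
      using orth t(3) by eventually_elim (simp add: K_def)
    moreover have "(\<phi> has_vector_derivative Y) (at (t 0))" using vel(1)[of t0] w0 t by simp
    moreover have "\<phi> (t 0) = x" using t t0 by simp
    ultimately have td: "(t has_real_derivative \<kappa>) (at 0)"
      using normal_speeds_agree[where \<phi> = \<phi> and t = t and a = a and v = v, OF x Y0 Y(2) a _ _ t(2) v(1,2)] by blast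
    show ?thesis
      unfolding has_circular_curvature_def
    proof (intro exI conjI ballI)
      show "min e \<epsilon> > 0" using e \<gamma> by simp
      show "unit_circle_param N x Y \<phi>" by fact
      show "(t has_real_derivative \<kappa>) (at 0)" by fact
      fix s assume "s \<in> {0 - min e \<epsilon><..<0 + min e \<epsilon>}"
      then have s: "\<bar>s\<bar> < e" "\<bar>s\<bar> < \<epsilon>" by auto
      show "\<phi> (t s) \<in> unit_sphere N" using vel(3) by (simp add: unit_sphere_def)
      show "vector_derivative \<phi> (at (t s)) = vector_derivative \<gamma> (at s)"
        using wv[OF s(1)] vd[OF s(2)] by simp
      show "positive_basis x Y (\<phi> (t s)) (vector_derivative \<gamma> (at s))"
        using pos(1)[of "t s"] wv[OF s(1)] vd[OF s(2)] by simp
      have wt: "?w (t s) \<noteq> 0" using pos(2) unit_nonzero by blast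
      show "birkhoff_orth_in N ?H (\<phi> (t s)) (span {vector_derivative \<gamma> (at s)})"
        using kernel_imp_birkhoff_orth_in[OF vel(3,4) subspace_span transversal_dim[OF x Y0 Y(2)] vel(6) wt vel(5)]
          wv[OF s(1)] vd[OF s(2)] by simp
    qed (rule refl)
  qed
  with uniq show ?thesis by blast
qed

end

section \<open>Curves on surfaces\<close>

text \<open>
  A left inverse of \<open>F'\<close> reduces the claim to a map \<open>\<Phi>\<close> whose derivative at \<open>u s\<close> is the identity. The
  difference quotients \<open>q\<close> of \<open>u\<close> and \<open>P\<close> of \<open>\<Phi> \<circ> u\<close> then satisfy \<open>norm (q - P) = E * norm q\<close> with \<open>E\<close> tending
  to \<open>0\<close>. Hence \<open>q\<close> stays bounded and has the same limit as \<open>P\<close>.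
\<close>

lemma differentiable_lift:
  fixes F :: "'a::euclidean_space \<Rightarrow> 'b::euclidean_space"
  assumes F: "(F has_derivative F') (at (u s))" "inj F'" and u: "isCont u s"
    and Fu: "((\<lambda>r. F (u r)) has_vector_derivative v) (at (s::real))"
  obtains z where "(u has_vector_derivative z) (at s)" "F' z = v"
proof -
  have lin: "linear F'" using F(1) by (rule has_derivative_linear)
  obtain B where B: "linear B" "B \<circ> F' = id"
    using linear_injective_left_inverse[OF lin F(2)] by blast
  define \<Phi> where "\<Phi> = (\<lambda>w. B (F w))"
  have BF: "B (F' h) = h" for h using fun_cong[OF B(2), of h] by simp
  from has_derivative_compose[OF F(1) linear_has_derivative[OF B(1)]]
  have \<Phi>d: "(\<Phi> has_derivative (\<lambda>h. h)) (at (u s))" by (simp add: \<Phi>_def BF)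
  from has_derivative_compose[OF Fu[unfolded has_vector_derivative_def] linear_has_derivative[OF B(1)]]
  have pd: "((\<lambda>r. \<Phi> (u r)) has_vector_derivative B v) (at s)"
    by (simp add: \<Phi>_def has_vector_derivative_def linear_scale[OF B(1)])
  define E where "E = (\<lambda>w. norm (\<Phi> w - \<Phi> (u s) - (w - u s)) / norm (w - u s))"
  define P where "P = (\<lambda>r. (\<Phi> (u r) - \<Phi> (u s)) /\<^sub>R (r - s))"
  define q where "q = (\<lambda>r. (u r - u s) /\<^sub>R (r - s))"
  have P: "(P \<longlongrightarrow> B v) (at s)"
    using pd by (simp add: has_vector_derivative_iff_slope P_def)
  have "(E \<longlongrightarrow> 0) (at (u s))"
    using \<Phi>d unfolding has_derivative_iff_norm E_def by blast
  moreover have "E (u s) = 0" by (simp add: E_def)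
  ultimately have "isCont E (u s)" by (simp add: isCont_def)
  then have "isCont (\<lambda>r. E (u r)) s" by (rule isCont_o2[OF u])
  then have E: "((\<lambda>r. E (u r)) \<longlongrightarrow> 0) (at s)" using \<open>E (u s) = 0\<close> by (simp add: isCont_def)
  have "\<forall>\<^sub>F r in at s. E (u r) < 1 / 2" by (rule order_tendstoD(2)[OF E]) simp
  then have "\<forall>\<^sub>F r in at s. norm (q r - P r) \<le> 2 * E (u r) * norm (P r)"
  proof eventually_elim
    case (elim r)
    have E0: "E (u r) \<ge> 0" by (simp add: E_def)
    have "q r - P r = (- 1 / (r - s)) *\<^sub>R (\<Phi> (u r) - \<Phi> (u s) - (u r - u s))"
      by (simp add: q_def P_def scaleR_diff_right divide_inverse)
    then have "norm (q r - P r) = \<bar>inverse (r - s)\<bar> * norm (\<Phi> (u r) - \<Phi> (u s) - (u r - u s))"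
      by (simp add: divide_inverse)
    also have "norm (\<Phi> (u r) - \<Phi> (u s) - (u r - u s)) = E (u r) * norm (u r - u s)"
      by (cases "u r = u s") (simp_all add: E_def)
    finally have 1: "norm (q r - P r) = E (u r) * norm (q r)" by (simp add: q_def)
    have "norm (q r) \<le> norm (P r) + norm (q r - P r)" using norm_triangle_ineq[of "P r" "q r - P r"] by simp
    also have "\<dots> \<le> norm (P r) + 1 / 2 * norm (q r)"
      unfolding 1 using elim by (intro add_left_mono mult_right_mono) auto
    finally have "norm (q r) \<le> 2 * norm (P r)" by simp
    then have "E (u r) * norm (q r) \<le> E (u r) * (2 * norm (P r))" using E0 by (rule mult_left_mono)
    then show ?case using 1 by simp
  qed
  moreover have "((\<lambda>r. 2 * E (u r) * norm (P r)) \<longlongrightarrow> 2 * 0 * norm (B v)) (at s)"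
    by (intro tendsto_intros E P)
  then have "((\<lambda>r. 2 * E (u r) * norm (P r)) \<longlongrightarrow> 0) (at s)" by simp
  ultimately have "((\<lambda>r. q r - P r) \<longlongrightarrow> 0) (at s)" by (rule Lim_null_comparison)
  then have "((\<lambda>r. (q r - P r) + P r) \<longlongrightarrow> 0 + B v) (at s)" using P by (rule tendsto_add)
  then have ud: "(u has_vector_derivative B v) (at s)"
    by (simp add: has_vector_derivative_iff_slope q_def)
  from has_derivative_compose[OF ud[unfolded has_vector_derivative_def] F(1)]
  have "((\<lambda>r. F (u r)) has_vector_derivative F' (B v)) (at s)"
    by (simp add: has_vector_derivative_def linear_scale[OF lin])
  then have "F' (B v) = v" using Fu by (rule vector_derivative_unique_at)
  with ud show thesis by (rule that)
qed

lemma chart_properties: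
  assumes "smooth_surface M A" "(D, \<psi>) \<in> A"
  shows "open D" "openin M (\<psi> ` D)" "homeomorphic_map (top_of_set D) (subtopology M (\<psi> ` D)) \<psi>"
    "inj_on \<psi> D" "continuous_map (top_of_set D) M \<psi>"
proof -
  show "open D" "openin M (\<psi> ` D)" and h: "homeomorphic_map (top_of_set D) (subtopology M (\<psi> ` D)) \<psi>"
    using assms unfolding smooth_surface_def by blast+
  show "inj_on \<psi> D" using h by (simp add: homeomorphic_map_def)
  show "continuous_map (top_of_set D) M \<psi>"
    using homeomorphic_imp_continuous_map[OF h] by (simp add: continuous_map_in_subtopology)
qed

lemma chart_vimage_open:
  assumes "smooth_surface M A" "(D, \<psi>) \<in> A" "openin M W"
  shows "open (D \<inter> \<psi> -` W)"
proof -
  note ch = chart_properties[OF assms(1,2)]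
  have "openin (top_of_set D) {x \<in> topspace (top_of_set D). \<psi> x \<in> W}"
    using ch(5) assms(3) by (rule openin_continuous_map_preimage)
  moreover have "{x \<in> topspace (top_of_set D). \<psi> x \<in> W} = D \<inter> \<psi> -` W" by auto
  ultimately show ?thesis using ch(1) openin_open_trans by metis
qed

lemma smooth_map_on_differentiable:
  assumes "smooth_map_on A W g" "(D, \<psi>) \<in> A" "u \<in> D" "\<psi> u \<in> W"
  shows "((g \<circ> \<psi>) has_derivative frechet_derivative (g \<circ> \<psi>) (at u)) (at u)"
proof -
  have "smooth_on (D \<inter> \<psi> -` W) (g \<circ> \<psi>)" using assms(1,2) unfolding smooth_map_on_def by blast
  then have "(g \<circ> \<psi>) differentiable at u" by (rule smooth_on_differentiable) (use assms in auto)
  then show ?thesis by (simp add: frechet_derivative_works)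
qed

lemma smooth_immersion_derivative:
  assumes S: "smooth_surface M A" and f: "smooth_immersion M A f" and c: "(D, \<psi>) \<in> A" "u \<in> D"
  shows "((f \<circ> \<psi>) has_derivative frechet_derivative (f \<circ> \<psi>) (at u)) (at u)"
    and "inj (frechet_derivative (f \<circ> \<psi>) (at u))"
proof -
  have "\<psi> u \<in> topspace M" using openin_subset[OF chart_properties(2)[OF S c(1)]] c(2) by blast
  then show "((f \<circ> \<psi>) has_derivative frechet_derivative (f \<circ> \<psi>) (at u)) (at u)"
    using f c unfolding smooth_immersion_def by (intro smooth_map_on_differentiable) auto
  show "inj (frechet_derivative (f \<circ> \<psi>) (at u))"
    using f c unfolding smooth_immersion_def by blast
qed

text \<open>
  The definite description is well defined: a second chart is related to the first one by a smooth
  transition map \<open>\<theta>\<close>, and since \<open>df\<close> is injective, the chain rule identifies the two coordinate vectors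
  of a tangent vector through \<open>d\<theta>\<close>.
\<close>

lemma surface_differential_eq:
  assumes S: "smooth_surface M A" and f: "smooth_immersion M A f" and g: "smooth_map_on A W g"
    and c: "(D, \<psi>) \<in> A" "u \<in> D" "\<psi> u \<in> W"
  shows "surface_differential A f g (\<psi> u) (frechet_derivative (f \<circ> \<psi>) (at u) h)
    = frechet_derivative (g \<circ> \<psi>) (at u) h"
  unfolding surface_differential_def
proof (rule the_equality)
  show "\<exists>(D', \<psi>')\<in>A. \<exists>u'\<in>D'. \<psi>' u' = \<psi> u \<and> (\<exists>h'.
      frechet_derivative (f \<circ> \<psi>) (at u) h = frechet_derivative (f \<circ> \<psi>') (at u') h' \<and>
      frechet_derivative (g \<circ> \<psi>) (at u) h = frechet_derivative (g \<circ> \<psi>') (at u') h')"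
    using c(1,2) by blast
next
  fix Z
  assume "\<exists>(D', \<psi>')\<in>A. \<exists>u'\<in>D'. \<psi>' u' = \<psi> u \<and> (\<exists>h'.
      frechet_derivative (f \<circ> \<psi>) (at u) h = frechet_derivative (f \<circ> \<psi>') (at u') h' \<and>
      Z = frechet_derivative (g \<circ> \<psi>') (at u') h')"
  then obtain D' \<psi>' u' h' where c': "(D', \<psi>') \<in> A" "u' \<in> D'" "\<psi>' u' = \<psi> u"
    and X: "frechet_derivative (f \<circ> \<psi>) (at u) h = frechet_derivative (f \<circ> \<psi>') (at u') h'"
    and Z: "Z = frechet_derivative (g \<circ> \<psi>') (at u') h'"
    by blast
  define \<theta> where "\<theta> = inv_into D' \<psi>' \<circ> \<psi>"
  define O' where "O' = D \<inter> \<psi> -` (\<psi>' ` D')"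
  have O': "open O'" "u \<in> O'"
    using chart_vimage_open[OF S c(1) chart_properties(2)[OF S c'(1)]] c(2) c'(2,3)
    by (auto simp: O'_def intro!: image_eqI[of _ _ u'])
  have "\<theta> u = u'"
    using chart_properties(4)[OF S c'(1)] c'(2,3) by (metis \<theta>_def comp_apply inv_into_f_f)
  have "smooth_on O' \<theta>"
    using S c(1) c'(1) unfolding smooth_surface_def \<theta>_def O'_def by blast
  then obtain \<theta>' where \<theta>': "(\<theta> has_derivative \<theta>') (at u)"
    using smooth_on_differentiable[OF _ O'(2)] unfolding differentiable_def by blast
  have chain: "frechet_derivative (k \<circ> \<psi>) (at u) v = frechet_derivative (k \<circ> \<psi>') (at u') (\<theta>' v)"
    if "((k \<circ> \<psi>') has_derivative frechet_derivative (k \<circ> \<psi>') (at u')) (at u')" for k :: "'a \<Rightarrow> real^3" and v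
  proof -
    have "((\<lambda>x. (k \<circ> \<psi>') (\<theta> x)) has_derivative (\<lambda>v. frechet_derivative (k \<circ> \<psi>') (at u') (\<theta>' v))) (at u)"
      using has_derivative_compose[OF \<theta>', of "k \<circ> \<psi>'"] that \<open>\<theta> u = u'\<close> by simp
    then have "((k \<circ> \<psi>) has_derivative (\<lambda>v. frechet_derivative (k \<circ> \<psi>') (at u') (\<theta>' v))) (at u)"
      by (rule has_derivative_transform_within_open[OF _ O'])
        (auto simp: O'_def \<theta>_def f_inv_into_f)
    from fun_cong[OF frechet_derivative_at[OF this], of v] show ?thesis by simp
  qed
  have "frechet_derivative (f \<circ> \<psi>') (at u') (\<theta>' h) = frechet_derivative (f \<circ> \<psi>') (at u') h'"
    using chain[OF smooth_immersion_derivative(1)[OF S f c'(1,2)]] X by metis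
  then have "\<theta>' h = h'"
    using smooth_immersion_derivative(2)[OF S f c'(1,2)] by (simp add: inj_eq)
  then show "Z = frechet_derivative (g \<circ> \<psi>) (at u) h"
    using chain[OF smooth_map_on_differentiable[OF g c'(1,2)]] c'(3) c(3) Z by simp
qed

lemma chart_lift:
  assumes S: "smooth_surface M A" and c: "(D, \<psi>) \<in> A"
    and k: "continuous_map (top_of_set I) M k" "open I"
  obtains J u where "open J" "J = {r \<in> I. k r \<in> \<psi> ` D}" "continuous_on J u"
    "\<And>r. r \<in> J \<Longrightarrow> u r \<in> D \<and> \<psi> (u r) = k r"
proof -
  note ch = chart_properties[OF S c]
  define J where "J = {r \<in> I. k r \<in> \<psi> ` D}"
  have "openin (top_of_set I) {x \<in> topspace (top_of_set I). k x \<in> \<psi> ` D}"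
    using k(1) ch(2) by (rule openin_continuous_map_preimage)
  then have J: "open J" using k(2) openin_open_trans by (auto simp: J_def)
  obtain lift where lift: "homeomorphic_maps (top_of_set D) (subtopology M (\<psi> ` D)) \<psi> lift"
    using ch(3) homeomorphic_map_maps by blast
  have top: "topspace (subtopology M (\<psi> ` D)) = \<psi> ` D"
    using openin_subset[OF ch(2)] by auto
  have kJ: "continuous_map (top_of_set J) (subtopology M (\<psi> ` D)) k"
    using continuous_map_from_subtopology_mono[OF k(1), of J]
    by (auto simp: continuous_map_in_subtopology J_def)
  have liftc: "continuous_map (subtopology M (\<psi> ` D)) (top_of_set D) lift"
    using lift by (simp add: homeomorphic_maps_def)
  have "continuous_map (top_of_set J) (top_of_set D) (lift \<circ> k)"
    using kJ liftc by (rule continuous_map_compose)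
  then have u: "continuous_on J (lift \<circ> k)" "(lift \<circ> k) ` J \<subseteq> D" by auto
  have "(lift \<circ> k) r \<in> D \<and> \<psi> ((lift \<circ> k) r) = k r" if "r \<in> J" for r
  proof
    show "(lift \<circ> k) r \<in> D" using u(2) that by blast
    have "k r \<in> topspace (subtopology M (\<psi> ` D))" using that top by (auto simp: J_def)
    then show "\<psi> ((lift \<circ> k) r) = k r" using lift by (simp add: homeomorphic_maps_def)
  qed
  then show thesis using that[of J "lift \<circ> k"] J u(1) J_def by blast
qed

text \<open>
  In a chart the curve is only known to be continuous, but \<open>differentiable_lift\<close> makes it differentiable
  because \<open>f \<circ> k\<close> is. The chain rule then applies to every smooth map on the surface.
\<close>

lemma surface_curve_velocity:
  assumes S: "smooth_surface M A" and f: "smooth_immersion M A f" and g: "smooth_map_on A W g"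
    and k: "continuous_map (top_of_set I) M k" "open I" and s: "s \<in> I" "k s \<in> W"
    and v: "((f \<circ> k) has_vector_derivative v) (at s)"
  shows "v \<in> tangent_plane A f (k s)"
    and "((g \<circ> k) has_vector_derivative surface_differential A f g (k s) v) (at s)"
proof -
  have "k s \<in> topspace M" using k(1) s by (auto simp: continuous_map_def)
  then obtain D \<psi> where c: "(D, \<psi>) \<in> A" and ks: "k s \<in> \<psi> ` D"
    using S unfolding smooth_surface_def by blast
  obtain J u where J: "open J" "J = {r \<in> I. k r \<in> \<psi> ` D}" and u: "continuous_on J u"
    and \<psi>u: "\<And>r. r \<in> J \<Longrightarrow> u r \<in> D \<and> \<psi> (u r) = k r"
    using chart_lift[OF S c k] by blast
  have sJ: "s \<in> J" using s ks J by simp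
  have us: "u s \<in> D" "\<psi> (u s) = k s" using \<psi>u[OF sJ] by auto
  have uc: "isCont u s" using u J(1) sJ continuous_on_eq_continuous_at by blast
  have fu: "((\<lambda>r. (f \<circ> \<psi>) (u r)) has_vector_derivative v) (at s)"
    using v by (rule has_vector_derivative_transform_within_open[OF _ J(1) sJ]) (use \<psi>u in simp)
  obtain z where z: "(u has_vector_derivative z) (at s)" "frechet_derivative (f \<circ> \<psi>) (at (u s)) z = v"
    using differentiable_lift[of "f \<circ> \<psi>" _ u s, OF smooth_immersion_derivative[OF S f c us(1)] uc fu] by blast
  show "v \<in> tangent_plane A f (k s)"
    unfolding tangent_plane_def using c us z(2) by blast
  have gd: "((g \<circ> \<psi>) has_derivative frechet_derivative (g \<circ> \<psi>) (at (u s))) (at (u s))"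
    using smooth_map_on_differentiable[OF g c us(1)] us(2) s(2) by simp
  from has_derivative_compose[OF z(1)[unfolded has_vector_derivative_def] gd]
  have "((\<lambda>r. (g \<circ> \<psi>) (u r)) has_vector_derivative frechet_derivative (g \<circ> \<psi>) (at (u s)) z) (at s)"
    by (simp add: has_vector_derivative_def linear_scale[OF has_derivative_linear[OF gd]])
  then have "((g \<circ> k) has_vector_derivative frechet_derivative (g \<circ> \<psi>) (at (u s)) z) (at s)"
    by (rule has_vector_derivative_transform_within_open[OF _ J(1) sJ]) (use \<psi>u in simp)
  moreover have "surface_differential A f g (k s) v = frechet_derivative (g \<circ> \<psi>) (at (u s)) z"
    using surface_differential_eq[OF S f g c us(1), of z] us(2) s(2) z(2) by simp
  ultimately show "((g \<circ> k) has_vector_derivative surface_differential A f g (k s) v) (at s)" by simp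
qed

section \<open>Normal sections\<close>

lemma codim_one_subspace_eq_kernel:
  fixes H :: "'a::euclidean_space set"
  assumes "subspace H" "dim H + 1 = DIM('a)"
  obtains a where "H = {z. a \<bullet> z = 0}"
proof -
  obtain a where a: "a \<noteq> 0" "span H \<subseteq> {z. a \<bullet> z = 0}"
    using lowdim_subset_hyperplane[of H] assms(2) by auto
  have "H = {z. a \<bullet> z = 0}"
    using assms a by (intro subspace_dim_equal subspace_hyperplane)
      (auto simp: dim_hyperplane span_eq_iff[THEN iffD2])
  then show thesis by (rule that)
qed

text \<open>
  In finite dimension, continuity of every \<open>T x v\<close> in \<open>x\<close> is joint continuity, by expansion in a basis.
\<close>

lemma continuous_on_linear_family:
  fixes T :: "'x::topological_space \<Rightarrow> 'a::euclidean_space \<Rightarrow> 'b::real_normed_vector"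
  assumes lin: "\<And>x. x \<in> S \<Longrightarrow> linear (T x)" and T: "\<And>v. continuous_on S (\<lambda>x. T x v)"
    and d: "continuous_on S d"
  shows "continuous_on S (\<lambda>x. T x (d x))"
proof -
  have "continuous_on S (\<lambda>x. \<Sum>b\<in>Basis. (d x \<bullet> b) *\<^sub>R T x b)"
    by (intro continuous_intros T d)
  then show ?thesis
  proof (rule continuous_on_eq)
    fix x assume "x \<in> S"
    then have "T x (\<Sum>b\<in>Basis. (d x \<bullet> b) *\<^sub>R b) = (\<Sum>b\<in>Basis. (d x \<bullet> b) *\<^sub>R T x b)"
      using lin by (simp add: linear_sum linear_scale)
    then show "(\<Sum>b\<in>Basis. (d x \<bullet> b) *\<^sub>R T x b) = T x (d x)"
      by (simp add: euclidean_representation)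
  qed
qed

context curved_norm
begin

text \<open>
  The speed is defined on an interval only. Freezing it outside a compact subinterval extends it to a
  continuous function on the line with a positive lower bound, to which
  \<open>arc_length_reparametrization\<close> applies; near \<open>0\<close> nothing changes.
\<close>

lemma unit_speed_reparametrization:
  assumes \<delta>: "\<delta> > 0" and v: "continuous_on {-\<delta><..<\<delta>} v" "\<And>r. r \<in> {-\<delta><..<\<delta>} \<Longrightarrow> v r \<noteq> 0"
  obtains \<epsilon> \<mu> L where "\<epsilon> > 0" "\<mu> 0 = 0" "\<mu> ` {-\<epsilon><..<\<epsilon>} \<subseteq> {-\<delta><..<\<delta>}" "open (\<mu> ` {-\<epsilon><..<\<epsilon>})"
    "homeomorphism {-\<epsilon><..<\<epsilon>} (\<mu> ` {-\<epsilon><..<\<epsilon>}) \<mu> L"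
    "\<And>s. s \<in> {-\<epsilon><..<\<epsilon>} \<Longrightarrow> (\<mu> has_real_derivative 1 / N (v (\<mu> s))) (at s)"
proof -
  define clamp where "clamp = (\<lambda>r::real. max (- \<delta> / 2) (min (\<delta> / 2) r))"
  have clamp: "clamp r \<in> {- \<delta> / 2..\<delta> / 2}" for r using \<delta> by (auto simp: clamp_def)
  have clampc: "continuous_on UNIV clamp" unfolding clamp_def by (intro continuous_intros)
  have sub: "{- \<delta> / 2..\<delta> / 2} \<subseteq> {-\<delta><..<\<delta>}" using \<delta> by auto
  define \<rho> where "\<rho> = (\<lambda>r. N (v (clamp r)))"
  have Nc: "continuous_on UNIV N" using N_continuous by (simp add: continuous_on_eq_continuous_at)
  have vN: "continuous_on {-\<delta><..<\<delta>} (\<lambda>r. N (v r))"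
    by (rule continuous_on_compose2[OF Nc v(1)]) simp
  have "continuous_on UNIV \<rho>"
    unfolding \<rho>_def by (rule continuous_on_compose2[OF vN clampc]) (use clamp sub in blast)
  then have \<rho>c: "isCont \<rho> r" for r by (simp add: continuous_on_eq_continuous_at)
  have "continuous_on {- \<delta> / 2..\<delta> / 2} (\<lambda>r. N (v r))" using vN sub by (rule continuous_on_subset)
  then obtain r0 where r0: "r0 \<in> {- \<delta> / 2..\<delta> / 2}" "\<And>r. r \<in> {- \<delta> / 2..\<delta> / 2} \<Longrightarrow> N (v r0) \<le> N (v r)"
    using continuous_attains_inf[of "{- \<delta> / 2..\<delta> / 2}" "\<lambda>r. N (v r)"] \<delta> by force
  have "N (v r0) > 0" using v(2) r0(1) sub N_pos by blast
  moreover have "N (v r0) \<le> \<rho> r" for r unfolding \<rho>_def using r0(2) clamp by blast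
  ultimately obtain \<mu> L where \<mu>: "\<mu> 0 = 0" "\<And>s. L (\<mu> s) = s" "\<And>r. \<mu> (L r) = r"
    "\<And>s. (\<mu> has_real_derivative 1 / \<rho> (\<mu> s)) (at s)" and Lc: "\<And>r. isCont L r"
    using arc_length_reparametrization[OF \<rho>c] by metis
  have \<mu>c: "isCont \<mu> s" for s using \<mu>(4) by (rule DERIV_isCont)
  have "(\<mu> \<longlongrightarrow> 0) (at 0)" using \<mu>c[of 0] by (simp add: isCont_def \<mu>(1))
  from LIM_D[OF this, of "\<delta> / 2"] obtain \<epsilon> where \<epsilon>: "\<epsilon> > 0" "\<And>s. s \<noteq> 0 \<Longrightarrow> \<bar>s\<bar> < \<epsilon> \<Longrightarrow> \<bar>\<mu> s\<bar> < \<delta> / 2"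
    using \<delta> by auto
  have half: "\<bar>\<mu> s\<bar> < \<delta> / 2" if "s \<in> {-\<epsilon><..<\<epsilon>}" for s
    using \<epsilon>(2)[of s] that \<mu>(1) \<delta> by (cases "s = 0") auto
  let ?I = "{-\<epsilon><..<\<epsilon>}"
  have img: "\<mu> ` ?I = L -` ?I"
  proof (intro equalityI subsetI)
    fix r assume "r \<in> L -` ?I"
    then have "L r \<in> ?I" by simp
    then have "\<mu> (L r) \<in> \<mu> ` ?I" by (rule imageI)
    then show "r \<in> \<mu> ` ?I" by (simp only: \<mu>(3))
  qed (use \<mu>(2) in auto)
  have Lc': "continuous_on S L" for S using Lc by (simp add: continuous_at_imp_continuous_on)
  show thesis
  proof (rule that[of \<epsilon> \<mu> L, OF \<epsilon>(1) \<mu>(1)])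
    show "\<mu> ` ?I \<subseteq> {-\<delta><..<\<delta>}"
    proof (rule image_subsetI)
      show "\<mu> s \<in> {-\<delta><..<\<delta>}" if "s \<in> ?I" for s using half[OF that] \<delta> by auto
    qed
    show "open (\<mu> ` ?I)" unfolding img by (rule open_vimage[OF open_greaterThanLessThan Lc'])
    show "homeomorphism ?I (\<mu> ` ?I) \<mu> L"
      by (rule homeomorphismI) (use \<mu>c Lc' \<mu>(2,3) in \<open>auto simp: continuous_at_imp_continuous_on\<close>)
    show "(\<mu> has_real_derivative 1 / N (v (\<mu> s))) (at s)" if "s \<in> ?I" for s
    proof -
      have "clamp (\<mu> s) = \<mu> s" using half[OF that] by (auto simp: clamp_def)
      then show ?thesis using \<mu>(4)[of s] by (simp add: \<rho>_def)
    qed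
  qed
qed

text \<open>
  The plane through \<open>p\<close> spanned by \<open>x\<close> and \<open>Y\<close> is transversal to the surface, since \<open>x\<close> is not tangent.
  So in a chart the section is a regular level curve of a linear functional \<open>a\<close> with kernel
  \<open>span {x, Y}\<close>, and its tangent at \<open>p\<close> is spanned by \<open>Y\<close>.
\<close>

lemma normal_section_exists:
  assumes S: "smooth_surface M A" and f: "smooth_immersion M A f"
    and T: "tangent_plane A f p = {h. G x \<bullet> h = 0}" and x: "N x = 1"
    and Y: "N Y = 1" "Y \<in> tangent_plane A f p"
  obtains c where "normal_section_param N M f p (span {x, Y}) Y c"
proof -
  have Y0: "Y \<noteq> 0" and GY: "G x \<bullet> Y = 0" using Y T by auto
  have Gx: "G x \<bullet> x = 1" using G_self[OF unit_nonzero[OF x]] x by simp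
  let ?H = "span {x, Y}"
  from Y(2) obtain D \<psi> u0 h1 where c: "(D, \<psi>) \<in> A" and u0: "u0 \<in> D" "\<psi> u0 = p"
    and h1: "Y = frechet_derivative (f \<circ> \<psi>) (at u0) h1"
    unfolding tangent_plane_def by blast
  note ch = chart_properties[OF S c]
  define F where "F = f \<circ> \<psi>"
  define F' where "F' = (\<lambda>u. frechet_derivative F (at u))"
  have Fd: "(F has_derivative F' u) (at u)" and Finj: "inj (F' u)" if "u \<in> D" for u
    using smooth_immersion_derivative[OF S f c that] by (simp_all add: F_def F'_def)
  have Flin: "linear (F' u)" if "u \<in> D" for u using Fd[OF that] by (rule has_derivative_linear)
  have Fc: "continuous_on D (\<lambda>u. F' u v)" for v
  proof -
    have "smooth_on (D \<inter> \<psi> -` topspace M) F"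
      using f c unfolding smooth_immersion_def smooth_map_on_def F_def by blast
    moreover have "D \<inter> \<psi> -` topspace M = D" using openin_subset[OF ch(2)] by auto
    ultimately show ?thesis unfolding F'_def by (metis smooth_on_derivative_continuous)
  qed
  have Fu0: "F u0 = f p" and Fh1: "F' u0 h1 = Y" using u0 h1 by (simp_all add: F_def F'_def)
  have FT: "G x \<bullet> F' u0 v = 0" for v
  proof -
    have "F' u0 v \<in> tangent_plane A f p"
      unfolding tangent_plane_def F'_def F_def using c u0 by blast
    then show ?thesis using T by simp
  qed
  have h10: "h1 \<noteq> 0" using Fh1 Y0 linear_0[OF Flin[OF u0(1)]] by auto
  obtain a where a: "?H = {z. a \<bullet> z = 0}"
    using codim_one_subspace_eq_kernel[of ?H] transversal_dim[OF x Y0 GY] by auto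
  define h where "h = (\<lambda>u. a \<bullet> (F u - f p))"
  define h' where "h' = (\<lambda>u v. a \<bullet> F' u v)"
  have hd: "(h has_derivative h' u) (at u)" if "u \<in> D" for u
    unfolding h_def h'_def
    by (intro has_derivative_inner_right) (use has_derivative_diff[OF Fd[OF that] has_derivative_const] in simp)
  have ker: "h' u0 v = 0 \<longleftrightarrow> v \<in> span {h1}" for v
  proof
    assume "h' u0 v = 0"
    then have "F' u0 v \<in> ?H" by (simp add: a h'_def)
    then obtain k b where kb: "F' u0 v = k *\<^sub>R x + b *\<^sub>R Y" by (rule span_pair_obtain)
    then have "k = 0" using FT[of v] Gx GY by (simp add: inner_add_right)
    then have "F' u0 v = F' u0 (b *\<^sub>R h1)" using kb by (simp add: linear_scale[OF Flin[OF u0(1)]] Fh1)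
    then have "v = b *\<^sub>R h1" using Finj[OF u0(1)] by (simp add: inj_eq)
    then show "v \<in> span {h1}" by (simp add: span_scale span_base)
  next
    assume "v \<in> span {h1}"
    then obtain b where "v = b *\<^sub>R h1" by (auto simp: span_singleton)
    then have "F' u0 v = b *\<^sub>R Y" by (simp add: linear_scale[OF Flin[OF u0(1)]] Fh1)
    then have "F' u0 v \<in> ?H" by (simp add: span_scale span_base)
    then show "h' u0 v = 0" by (simp add: a h'_def)
  qed
  have "\<exists>v. h' u0 v \<noteq> 0"
  proof (rule ccontr)
    assume "\<nexists>v. h' u0 v \<noteq> 0"
    then have "(UNIV :: (real^2) set) \<subseteq> span {h1}" using ker by blast
    then have "dim (UNIV :: (real^2) set) \<le> dim (span {h1})" by (rule dim_subset)
    then show False using h10 by (simp add: dim_insert)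
  qed
  then obtain v2 where v2: "h' u0 v2 \<noteq> 0" by blast
  define h2 where "h2 = v2 /\<^sub>R h' u0 v2"
  have h2: "h' u0 h2 = 1" using v2 by (simp add: h2_def linear_scale[OF has_derivative_linear[OF hd[OF u0(1)]]])
  have hc: "continuous_on D (\<lambda>u. h' u v)" for v unfolding h'_def by (intro continuous_intros Fc)
  have h0: "h u0 = 0" by (simp add: h_def Fu0)
  obtain \<delta> X \<sigma> \<tau> d where \<delta>: "\<delta> > 0" and X: "open X" "u0 \<in> X" "X \<subseteq> D" and \<sigma>0: "\<sigma> 0 = u0"
    and hom: "homeomorphism {-\<delta><..<\<delta>} {u \<in> X. h u = 0} \<sigma> \<tau>"
    and \<sigma>d: "\<And>r. r \<in> {-\<delta><..<\<delta>} \<Longrightarrow> (\<sigma> has_vector_derivative d r) (at r)"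
    and dc: "continuous_on {-\<delta><..<\<delta>} d" and d0: "d 0 = h1"
    and dnz: "\<And>r. r \<in> {-\<delta><..<\<delta>} \<Longrightarrow> d r \<noteq> 0"
    by (rule level_curve[OF ch(1) u0(1) hd hc h0 ker h10 h2], assumption) (rule that)
  have \<sigma>X: "\<sigma> r \<in> X" "h (\<sigma> r) = 0" "\<sigma> r \<in> D" if "r \<in> {-\<delta><..<\<delta>}" for r
    using homeomorphism_image1[OF hom] that X(3) by blast+
  define v where "v = (\<lambda>r. F' (\<sigma> r) (d r))"
  have vd: "((\<lambda>r. F (\<sigma> r)) has_vector_derivative v r) (at r)" if "r \<in> {-\<delta><..<\<delta>}" for r
    using has_derivative_compose[OF \<sigma>d[OF that, unfolded has_vector_derivative_def] Fd[OF \<sigma>X(3)[OF that]]]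
    by (simp add: has_vector_derivative_def v_def linear_scale[OF Flin[OF \<sigma>X(3)[OF that]]])
  have vc: "continuous_on {-\<delta><..<\<delta>} v"
    unfolding v_def
  proof (rule continuous_on_linear_family[OF Flin[OF \<sigma>X(3)] _ dc])
    show "continuous_on {-\<delta><..<\<delta>} (\<lambda>r. F' (\<sigma> r) w)" for w
      by (rule continuous_on_compose2[OF Fc homeomorphism_cont1[OF hom]]) (use \<sigma>X(3) in blast)
  qed
  have vnz: "v r \<noteq> 0" if "r \<in> {-\<delta><..<\<delta>}" for r
    using Finj[OF \<sigma>X(3)[OF that]] dnz[OF that] linear_injective_0[OF Flin[OF \<sigma>X(3)[OF that]]]
    by (auto simp: v_def)
  obtain \<epsilon> \<mu> L where \<epsilon>: "\<epsilon> > 0" and \<mu>0: "\<mu> 0 = 0" and sub: "\<mu> ` {-\<epsilon><..<\<epsilon>} \<subseteq> {-\<delta><..<\<delta>}"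
    and op: "open (\<mu> ` {-\<epsilon><..<\<epsilon>})" and \<mu>hom: "homeomorphism {-\<epsilon><..<\<epsilon>} (\<mu> ` {-\<epsilon><..<\<epsilon>}) \<mu> L"
    and \<mu>d: "\<And>s. s \<in> {-\<epsilon><..<\<epsilon>} \<Longrightarrow> (\<mu> has_real_derivative 1 / N (v (\<mu> s))) (at s)"
    using unit_speed_reparametrization[OF \<delta> vc vnz] by metis
  let ?I = "{-\<epsilon><..<\<epsilon>}"
  let ?C = "\<sigma> ` \<mu> ` ?I"
  have \<mu>I: "\<mu> s \<in> {-\<delta><..<\<delta>}" if "s \<in> ?I" for s using sub that by blast
  have "openin (top_of_set {-\<delta><..<\<delta>}) (\<mu> ` ?I)"
    using op sub by (auto intro: open_openin_trans)
  \<comment> \<open>Passing to the interval of arc length shortens the level curve. The shorter arc is open in it, so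
    that a smaller neighbourhood of \<open>u0\<close> meets the plane in exactly this arc.\<close>
  from homeomorphism_imp_open_map[OF hom this]
  obtain X' where X': "open X'" "?C = {u \<in> X. h u = 0} \<inter> X'" by (auto simp: openin_open)
  define U where "U = \<psi> ` (X \<inter> X')"
  have "homeomorphism (\<mu> ` ?I) ?C \<sigma> \<tau>"
    by (rule homeomorphism_of_subsets[OF hom sub order_refl refl])
  from homeomorphism_compose[OF \<mu>hom this]
  have "homeomorphism ?I ?C (\<sigma> \<circ> \<mu>) (L \<circ> \<tau>)" .
  then have hom1: "homeomorphic_map (top_of_set ?I) (top_of_set ?C) (\<sigma> \<circ> \<mu>)"
    unfolding homeomorphic_map_maps homeomorphic_maps_def homeomorphism_def
    by (intro exI[of _ "L \<circ> \<tau>"]) auto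
  have CD: "?C \<subseteq> D" using X' X(3) by blast
  have top: "topspace (subtopology M (\<psi> ` D)) = \<psi> ` D"
    using openin_subset[OF ch(2)] by auto
  have "homeomorphic_map (subtopology (top_of_set D) ?C) (subtopology (subtopology M (\<psi> ` D)) (\<psi> ` ?C)) \<psi>"
    by (rule homeomorphic_map_subtopologies[OF ch(3)]) (use CD top in auto)
  moreover have "subtopology (top_of_set D) ?C = top_of_set ?C"
    using CD by (simp add: subtopology_subtopology Int_absorb1)
  moreover have "subtopology (subtopology M (\<psi> ` D)) (\<psi> ` ?C) = subtopology M (\<psi> ` ?C)"
    using CD by (simp add: subtopology_subtopology Int_absorb1 image_mono)
  ultimately have hom2: "homeomorphic_map (top_of_set ?C) (subtopology M (\<psi> ` ?C)) \<psi>" by simp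
  have sec: "{q \<in> U. f q - f p \<in> ?H} = \<psi> ` ?C"
    unfolding U_def X'(2) a by (auto simp: h_def F_def)
  have "homeomorphic_map (top_of_set ?I) (subtopology M {q \<in> U. f q - f p \<in> ?H}) (\<psi> \<circ> (\<sigma> \<circ> \<mu>))"
    unfolding sec by (rule homeomorphic_map_compose[OF hom1 hom2])
  moreover have "openin M U"
  proof (rule openin_trans_full[OF _ ch(2)])
    have "openin (top_of_set D) (X \<inter> X')"
      using X X' by (intro open_openin_trans[OF ch(1)]) auto
    then show "openin (subtopology M (\<psi> ` D)) U"
      unfolding U_def using homeomorphic_imp_open_map[OF ch(3)] by (simp add: open_map_def)
  qed
  moreover have "p \<in> U"
  proof -
    have "u0 \<in> ?C" using \<mu>0 \<sigma>0 \<epsilon> by (force intro!: image_eqI[of _ _ "0::real"])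
    then show ?thesis using X'(2) u0 by (auto simp: U_def)
  qed
  moreover have der: "((f \<circ> (\<psi> \<circ> (\<sigma> \<circ> \<mu>))) has_vector_derivative (1 / N (v (\<mu> s))) *\<^sub>R v (\<mu> s)) (at s)"
    if "s \<in> ?I" for s
    using vector_diff_chain_at[OF \<mu>d[OF that, unfolded has_real_derivative_iff_has_vector_derivative] vd[OF \<mu>I[OF that]]]
    by (simp add: o_def F_def)
  moreover have derc: "continuous_on ?I (\<lambda>s. (1 / N (v (\<mu> s))) *\<^sub>R v (\<mu> s))"
  proof -
    have "continuous_on ?I (\<lambda>s. v (\<mu> s))"
      by (rule continuous_on_compose2[OF vc homeomorphism_cont1[OF \<mu>hom] sub])
    moreover have "continuous_on UNIV N" using N_continuous by (simp add: continuous_on_eq_continuous_at)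
    ultimately have "continuous_on ?I (\<lambda>s. N (v (\<mu> s)))"
      by (intro continuous_on_compose2[of UNIV N ?I "\<lambda>s. v (\<mu> s)"]) auto
    moreover have "\<forall>s\<in>?I. N (v (\<mu> s)) \<noteq> 0" using vnz \<mu>I by simp
    ultimately show ?thesis
      using \<open>continuous_on ?I (\<lambda>s. v (\<mu> s))\<close>
      by (intro continuous_on_scaleR continuous_on_divide continuous_on_const)
  qed
  ultimately have "normal_section_param N M f p ?H Y (\<psi> \<circ> (\<sigma> \<circ> \<mu>))"
    unfolding normal_section_param_def
  proof (intro exI[of _ U] exI[of _ \<epsilon>] conjI ballI)
    show "\<epsilon> > 0" by fact
    show "(\<psi> \<circ> (\<sigma> \<circ> \<mu>)) 0 = p" using \<mu>0 \<sigma>0 u0 by simp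
    show "(f \<circ> (\<psi> \<circ> (\<sigma> \<circ> \<mu>))) C1_differentiable_on ?I"
      unfolding C1_differentiable_on_def 
      by (intro exI[of _ "\<lambda>s. (1 / N (v (\<mu> s))) *\<^sub>R v (\<mu> s)"] conjI ballI derc der)
    show "N (vector_derivative (f \<circ> (\<psi> \<circ> (\<sigma> \<circ> \<mu>))) (at s)) = 1" if "s \<in> ?I" for s
      using vector_derivative_at[OF der[OF that]] N_pos[OF vnz[OF \<mu>I[OF that]]] vnz[OF \<mu>I[OF that]]
      by (simp add: N_scale)
    have "v 0 = Y" by (simp add: v_def \<sigma>0 d0 Fh1)
    then show "vector_derivative (f \<circ> (\<psi> \<circ> (\<sigma> \<circ> \<mu>))) (at 0) = Y"
      using vector_derivative_at[OF der[of 0]] \<epsilon> \<mu>0 Y by simp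
  qed
  then show thesis by (rule that)
qed

text \<open>
  The normal field along the section provides the comparison curve \<open>\<eta> \<circ> c\<close>: its initial velocity is
  \<open>\<kappa> *\<^sub>R Y\<close> because \<open>Y\<close> is principal, and \<open>G (\<eta> (c s))\<close> annihilates the tangent plane, which contains
  the velocity of the section.
\<close>

lemma normal_section_curvature_iff:
  assumes strict: "\<And>a b. a \<noteq> b \<Longrightarrow> \<not> closed_segment a b \<subseteq> unit_sphere N"
    and S: "smooth_surface M A" and f: "smooth_immersion M A f"
    and \<eta>: "birkhoff_normal_field N M A f W \<eta>" and p: "p \<in> W"
    and Y: "N Y = 1" "Y \<in> tangent_plane A f p" and \<kappa>: "surface_differential A f \<eta> p Y = \<kappa> *\<^sub>R Y"
    and c: "normal_section_param N M f p (span {\<eta> p, Y}) Y c"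
  shows "has_circular_curvature N (\<eta> p) Y (f \<circ> c) 0 k \<longleftrightarrow> k = \<kappa>"
proof -
  let ?H = "span {\<eta> p, Y}"
  have W: "openin M W" and \<eta>s: "smooth_map_on A W \<eta>"
    using \<eta> by (simp_all add: birkhoff_normal_field_def)
  have unit: "N (\<eta> q) = 1" and T: "tangent_plane A f q = {h. G (\<eta> q) \<bullet> h = 0}" if "q \<in> W" for q
    using \<eta> that birkhoff_orth_in_imp_kernel[of UNIV "\<eta> q" "tangent_plane A f q"]
    by (auto simp: birkhoff_normal_field_def birkhoff_orth_def unit_sphere_def)
  have GY: "G (\<eta> p) \<bullet> Y = 0" using Y(2) T[OF p] by simp
  from c obtain U \<epsilon> where U: "openin M U" and \<epsilon>: "\<epsilon> > 0"
    and hom: "homeomorphic_map (top_of_set {-\<epsilon><..<\<epsilon>}) (subtopology M {q\<in>U. f q - f p \<in> ?H}) c"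
    and c0: "c 0 = p" and C1: "(f \<circ> c) C1_differentiable_on {-\<epsilon><..<\<epsilon>}"
    and speed: "\<And>s. s \<in> {-\<epsilon><..<\<epsilon>} \<Longrightarrow> N (vector_derivative (f \<circ> c) (at s)) = 1"
    and v0: "vector_derivative (f \<circ> c) (at 0) = Y"
    unfolding normal_section_param_def by blast
  let ?I = "{-\<epsilon><..<\<epsilon>}"
  let ?v = "\<lambda>s. vector_derivative (f \<circ> c) (at s)"
  have cc: "continuous_map (top_of_set ?I) M c" and cH: "\<And>s. s \<in> ?I \<Longrightarrow> f (c s) - f p \<in> ?H"
    using homeomorphic_imp_continuous_map[OF hom] by (auto simp: continuous_map_in_subtopology image_subset_iff Pi_iff)
  have vd: "((f \<circ> c) has_vector_derivative ?v s) (at s)" if "s \<in> ?I" for s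
    using C1 that by (simp add: C1_differentiable_on_eq vector_derivative_works)
  have vc: "continuous_on ?I ?v" using C1 by (simp add: C1_differentiable_on_eq)
  have I0: "0 \<in> ?I" using \<epsilon> by simp
  have near: "\<forall>\<^sub>F r in at s. r \<in> ?I" if "s \<in> ?I" for s
    using that by (intro eventually_at_in_open') auto
  have "openin (top_of_set ?I) {s \<in> topspace (top_of_set ?I). c s \<in> W}"
    using cc W by (rule openin_continuous_map_preimage)
  then have "open {s \<in> ?I. c s \<in> W}" using openin_open_trans[OF _ open_greaterThanLessThan] by simp
  then have inW: "\<forall>\<^sub>F s in at 0. s \<in> {s \<in> ?I. c s \<in> W}"
    using I0 c0 p by (intro eventually_at_in_open') auto
  show ?thesis
  proof (rule has_circular_curvature_iff[OF strict unit[OF p] Y(1) GY \<epsilon>])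
    show "((f \<circ> c) has_vector_derivative ?v s) (at s)" if "\<bar>s\<bar> < \<epsilon>" for s
      by (rule vd) (use that in auto)
    show "isCont ?v 0" using vc I0 by (simp add: continuous_on_eq_continuous_at)
    show "?v 0 = Y" by (rule v0)
    show "N (?v s) = 1 \<and> ?v s \<in> ?H" if "\<bar>s\<bar> < \<epsilon>" for s
    proof
      have s: "s \<in> ?I" using that by auto
      show "N (?v s) = 1" using speed[OF s] .
      have "\<forall>\<^sub>F r in at s. (f \<circ> c) r - f p \<in> ?H"
        using near[OF s] by eventually_elim (use cH in simp)
      then show "?v s \<in> ?H"
        using has_vector_derivative_in_subspace[OF vd[OF s] subspace_span] cH[OF s] by simp
    qed
    show "((\<eta> \<circ> c) has_vector_derivative \<kappa> *\<^sub>R Y) (at 0)"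
      using surface_curve_velocity(2)[OF S f \<eta>s cc open_greaterThanLessThan I0 _ vd[OF I0]] c0 p v0 \<kappa> by simp
    show "(\<eta> \<circ> c) 0 = \<eta> p" using c0 by simp
    show "\<forall>\<^sub>F s in at 0. G ((\<eta> \<circ> c) s) \<bullet> ?v s = 0"
      using inW
    proof eventually_elim
      case (elim s)
      then have s: "s \<in> ?I" "c s \<in> W" by auto
      have "?v s \<in> tangent_plane A f (c s)"
        using surface_curve_velocity(1)[OF S f \<eta>s cc open_greaterThanLessThan s vd[OF s(1)]] .
      then show ?case using T[OF s(2)] by simp
    qed
  qed
qed

end

theorem corollary5p2:
  fixes N :: "real^3 \<Rightarrow> real"
    and M :: "'m topology" and A :: "'m atlas"
    and f \<eta> :: "'m \<Rightarrow> real^3"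
    and W :: "'m set" and p :: 'm and V :: "real^3" and \<kappa> :: real
  assumes "admissible_norm N"
    and "smooth_surface M A"
    and "smooth_immersion M A f"
    and "birkhoff_normal_field N M A f W \<eta>"
    and "p \<in> W"
    and "principal_direction A f \<eta> p V \<kappa>"
  shows "normal_curvature N M f \<eta> p V = \<kappa>"
proof -
  interpret curved_norm N "gradient N"
    using assms(1) by (rule admissible_imp_curved_norm)
  have strict: "\<not> closed_segment a b \<subseteq> unit_sphere N" if "a \<noteq> b" for a b
    using assms(1) that by (simp add: admissible_norm_def)
  have unit: "N (\<eta> p) = 1" and T: "tangent_plane A f p = {h. gradient N (\<eta> p) \<bullet> h = 0}"
    using assms(4,5) birkhoff_orth_in_imp_kernel[of UNIV "\<eta> p" "tangent_plane A f p"]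
    by (auto simp: birkhoff_normal_field_def birkhoff_orth_def unit_sphere_def)
  have V: "V \<in> tangent_plane A f p" "V \<noteq> 0" "surface_differential A f \<eta> p V = \<kappa> *\<^sub>R V"
    using assms(6) by (simp_all add: principal_direction_def)
  define Y where "Y = V /\<^sub>R N V"
  have Y: "N Y = 1" "Y \<in> tangent_plane A f p"
    using V N_normalize T by (simp_all add: Y_def)
  \<comment> \<open>The differential is linear, so that a principal direction may be normalized.\<close>
  have dY: "surface_differential A f \<eta> p Y = \<kappa> *\<^sub>R Y"
  proof -
    from V(1) obtain D \<psi> u h where c: "(D, \<psi>) \<in> A" "u \<in> D" "\<psi> u = p"
      and h: "V = frechet_derivative (f \<circ> \<psi>) (at u) h"
      unfolding tangent_plane_def by blast
    have \<eta>: "smooth_map_on A W \<eta>" using assms(4) by (simp add: birkhoff_normal_field_def)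
    have uW: "\<psi> u \<in> W" using c assms(5) by simp
    have lf: "linear (frechet_derivative (f \<circ> \<psi>) (at u))"
      using smooth_immersion_derivative(1)[OF assms(2,3) c(1,2)] by (rule has_derivative_linear)
    have l\<eta>: "linear (frechet_derivative (\<eta> \<circ> \<psi>) (at u))"
      using smooth_map_on_differentiable[OF \<eta> c(1,2) uW] by (rule has_derivative_linear)
    note d = surface_differential_eq[OF assms(2,3) \<eta> c(1,2) uW, unfolded c(3)]
    have "surface_differential A f \<eta> p Y = frechet_derivative (\<eta> \<circ> \<psi>) (at u) (h /\<^sub>R N V)"
      using d[of "h /\<^sub>R N V"] by (simp add: linear_scale[OF lf] h[symmetric] Y_def)
    also have "\<dots> = surface_differential A f \<eta> p V /\<^sub>R N V"
      using d[of h] by (simp add: linear_scale[OF l\<eta>] h[symmetric])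
    finally show ?thesis using V(3) by (simp add: Y_def)
  qed
  obtain c0 where c0: "normal_section_param N M f p (span {\<eta> p, Y}) Y c0"
    using normal_section_exists[OF assms(2,3) T unit Y] .
  note curv = normal_section_curvature_iff[OF strict assms(2-5) Y dY]
  have "(THE k. \<exists>c. normal_section_param N M f p (span {\<eta> p, Y}) Y c \<and>
      has_circular_curvature N (\<eta> p) Y (f \<circ> c) 0 k) = \<kappa>"
    by (rule the_equality) (use c0 curv in blast)+
  then show ?thesis by (simp add: normal_curvature_def Y_def Let_def)
qed

end
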